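(* Let $k:\mathbb{R}\to\mathbb{R}$ denote a nonnegative kernel satisfying $$k(t)=O(|t|^{-(p+1)})\quad\text{and}\quad \mathcal{F}[k](\omega)=O(|\omega|^{-\ell})$$ for some $\ell>0$, $p>1$. Suppose that $0<\alpha<1/3$. If $$m\le\frac{n^{\frac23-2\left(\alpha(1-\frac2\ell)+\frac{2}{3\ell}\right)}}{\log n},$$ then $$\inf_{h,\,S:|S|\le m}\ \sup_{f\in\mathcal{P}_{\mathcal{H}}(1,L)}\mathbb{E}_f\|\hat f_S^{\mathsf{unif}}-f\|_2=\Omega_k\Big(\frac{n^{-\frac13+\alpha}}{\log n}\Big).$$ The infimum is over all choices of bandwidth $h>0$ and all coreset schemes $S$ of cardinality at most $m$.
   Context: Dimension $d=1$. A kernel is an even function $k:\mathbb{R}\to\mathbb{R}$ with $\int k=1$; $k_h(x)=h^{-1}k(x/h)$. $\mathcal{F}[k](\omega)=\int k(t)e^{-i\omega t}\,dt$. $\mathcal{P}_{\mathcal{H}}(1,L)$, $L>0$: probability densities $f:\mathbb{R}\to\mathbb{R}$ supported on $[-1/2,1/2]$ with $|f(x)-f(y)|\le L|x-y|$ for all $x,y\in\mathbb{R}$. $\mathbb{E}_f$ is expectation for $X_1,\dots,X_n$ i.i.d. with density $f$. $\|\cdot\|_2$ is the $L_2$ norm. A coreset scheme $S$ is a conditional probability measure on subsets of $[n]$ (of the given cardinality) given the data $X=(X_1,\dots,X_n)$; $S$ also denotes a sample from it. The uniformly weighted coreset KDE is $\hat f_S^{\mathsf{unif}}(y)=\frac1{|S|}\sum_{i\in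 S}k_h(X_i-y)$. $\Omega_k$ denotes an asymptotic lower bound as $n\to\infty$ up to a positive constant depending on $k$.
   Formalization: The Lipschitz constant is assumed to satisfy L > 4 instead of L > 0: for L < 4 the class P_H(1,L) is empty, and for L = 4 it contains only the tent density, for which the lower bound fails (e.g. Gaussian k). *)

theory Defs
  imports "HOL-Probability.Probability" "HOL-Library.Landau_Symbols"
begin

definition is_kernel :: "(real \<Rightarrow> real) \<Rightarrow> bool" where
  "is_kernel k \<longleftrightarrow> (\<forall>x. k (- x) = k x) \<and> has_bochner_integral lborel k 1"

definition scaled :: "(real \<Rightarrow> real) \<Rightarrow> real \<Rightarrow> real \<Rightarrow> real" where
  "scaled k h x = k (x / h) / h"

definition fourier :: "(real \<Rightarrow> real) \<Rightarrow> real \<Rightarrow> complex" where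
  "fourier k \<omega> = (\<integral>t. complex_of_real (k t) * iexp (- (\<omega> * t)) \<partial>lborel)"

(* Since f vanishes outside [-1/2, 1/2] and is Lipschitz on the whole line,
   f x \<le> L * (1/2 - |x|), so 1 = \<integral> f \<le> L / 4.  Hence the class is empty for L < 4, and for L = 4
   its only member is the tent 2 - 4 * |x| on [-1/2, 1/2]. *)
definition lipschitz_densities :: "real \<Rightarrow> (real \<Rightarrow> real) set" where
  "lipschitz_densities L = {f. (\<forall>x. 0 \<le> f x) \<and> has_bochner_integral lborel f 1 \<and>
     (\<forall>x. x \<notin> {-1/2..1/2} \<longrightarrow> f x = 0) \<and> L-lipschitz_on UNIV f}"

definition iid_sample :: "nat \<Rightarrow> (real \<Rightarrow> real) \<Rightarrow> (nat \<Rightarrow> real) measure" where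
  "iid_sample n f = (\<Pi>\<^sub>M i\<in>{..<n}. density lborel (\<lambda>x. ennreal (f x)))"

(* Markov kernels from the data space to the index sets of cardinality at most m *)
definition coreset_schemes :: "nat \<Rightarrow> nat \<Rightarrow> ((nat \<Rightarrow> real) \<Rightarrow> nat set measure) set" where
  "coreset_schemes n m =
     (\<Pi>\<^sub>M i\<in>{..<n}. borel) \<rightarrow>\<^sub>M prob_algebra (count_space {I. I \<subseteq> {..<n} \<and> card I \<le> m})"

(* For I = {} the value is 0 (division by zero).  The empty coreset is thus admitted,
   which can only decrease the infimum defining the minimax risk. *)
definition coreset_kde ::
    "(real \<Rightarrow> real) \<Rightarrow> real \<Rightarrow> (nat \<Rightarrow> real) \<Rightarrow> nat set \<Rightarrow> real \<Rightarrow> real" where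
  "coreset_kde k h X I y = (1 / real (card I)) * (\<Sum>i\<in>I. scaled k h (X i - y))"

(* Extended-valued: \<infinity> when g is not square integrable, as may happen for an unbounded kernel. *)
definition norm_L2 :: "(real \<Rightarrow> real) \<Rightarrow> ennreal" where
  "norm_L2 g = (let J = \<integral>\<^sup>+y. ennreal ((g y)\<^sup>2) \<partial>lborel
                in if J = \<infinity> then \<infinity> else ennreal (sqrt (enn2real J)))"

(* The outer integral is over the data, the inner one over the randomness of the scheme. *)
definition coreset_risk ::
    "(real \<Rightarrow> real) \<Rightarrow> nat \<Rightarrow> real \<Rightarrow> ((nat \<Rightarrow> real) \<Rightarrow> nat set measure) \<Rightarrow> (real \<Rightarrow> real) \<Rightarrow> ennreal"
where
  "coreset_risk k n h S f =
     (\<integral>\<^sup>+X. \<integral>\<^sup>+I. norm_L2 (\<lambda>y. coreset_kde k h X I y - f y) \<partial>S X \<partial>iid_sample n f)"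

definition minimax_coreset_risk :: "(real \<Rightarrow> real) \<Rightarrow> real \<Rightarrow> nat \<Rightarrow> nat \<Rightarrow> ennreal" where
  "minimax_coreset_risk k L n m =
     (INF h\<in>{0<..}. INF S\<in>coreset_schemes n m. SUP f\<in>lipschitz_densities L. coreset_risk k n h S f)"

end

theory Submission
  imports Defs "HOL-Real_Asymp.Real_Asymp"
begin

text \<open>
  Put \<open>N = n powr (1/3 - \<alpha>)\<close>, so that the rate is \<open>1 / (N * ln n)\<close> and the budget is
  \<open>m \<le> N powr (2 - 4/l) / ln n\<close>.  For every bandwidth there is one density on which every
  estimator, whichever points of \<open>[-1/2, 1/2]\<close> it uses, has error at least a constant times \<open>1/N\<close>;
  the constant depends on \<open>L\<close>, and the factor \<open>1 / ln n\<close> absorbs it.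

  If \<open>h \<ge> N powr (-1 + 2/l)\<close>, the Fourier transform of every estimator is at most of order
  \<open>1/N\<^sup>2\<close> at frequencies of order \<open>N\<close>, whereas a tent carrying a ripple of amplitude and period of
  order \<open>1/N\<close> has Fourier mass of order \<open>1/N\<close> there.
  The empty coreset is treated in the same way; it is the only one admitted when \<open>l \<le> 2\<close>.

  If \<open>h < N powr (-1 + 2/l)\<close>, take the density that has a fraction \<open>\<theta> = 1/N\<close> of its mass in a
  full tent and the rest in a tent that leaves a gap at the right end.  On the gap the density is of
  order \<open>\<theta>\<close>, so about \<open>\<theta> * m\<close> points of the coreset fall near it.  Each of them contributes a
  nonnegative spike of width \<open>h\<close>, and \<open>m * h * \<theta>\<close> tends to \<open>0\<close>, so the spikes cover a negligible
  part of the gap.  The far points cannot fill the gap through the tails of the kernel either: the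
  kernel is even, so equally heavy tails would leak out of \<open>[-1/2, 1/2]\<close> at the left end.
\<close>

section \<open>Integrals of square integrable functions\<close>

text \<open>Strictness excludes the value infinity, so the extended norm can be squared back to its
  integral.\<close>

lemma nn_integral_square_le_norm_L2:
  assumes "norm_L2 u < ennreal E"
  shows "(\<integral>\<^sup>+y. ennreal ((u y)\<^sup>2) \<partial>lborel) \<le> ennreal (E\<^sup>2)"
proof -
  define J where "J = (\<integral>\<^sup>+y. ennreal ((u y)\<^sup>2) \<partial>lborel)"
  have fin: "J \<noteq> \<infinity>" and less: "ennreal (sqrt (enn2real J)) < ennreal E"
    using assms unfolding norm_L2_def Let_def J_def[symmetric] by (auto split: if_splits)
  have "sqrt (enn2real J) < E"
    using less by (simp add: ennreal_less_iff)
  then have "enn2real J \<le> E\<^sup>2"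
    by (metis enn2real_nonneg less_imp_le real_sqrt_ge_zero power_mono real_sqrt_pow2)
  then have "J \<le> ennreal (E\<^sup>2)"
    by (metis ennreal_enn2real_if fin ennreal_leI infinity_ennreal_def)
  then show ?thesis by (simp add: J_def)
qed

text \<open>Cauchy-Schwarz, in the form in which both lower bounds refute a small error: the error
  \<open>u\<close> is tested against \<open>sine_window\<close> for large bandwidths and against the
  indicator of an interval for small ones.\<close>

lemma integral_abs_mult_le:
  fixes u \<phi> :: "real \<Rightarrow> real"
  assumes [measurable]: "u \<in> borel_measurable borel" "\<phi> \<in> borel_measurable borel"
    and E: "norm_L2 u < ennreal E"
    and B: "(\<integral>\<^sup>+y. ennreal ((\<phi> y)\<^sup>2) \<partial>lborel) \<le> ennreal (B\<^sup>2)" "0 \<le> B"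
  shows "integrable lborel (\<lambda>y. u y * \<phi> y)"
    and "(\<integral>y. \<bar>u y * \<phi> y\<bar> \<partial>lborel) \<le> B * E"
proof -
  have E0: "0 \<le> E"
    using E by (metis ennreal_neg less_le_not_le linorder_not_le not_gr_zero not_less_zero)
  have "(\<integral>\<^sup>+y. ennreal \<bar>u y\<bar> * ennreal \<bar>\<phi> y\<bar> \<partial>lborel)\<^sup>2 \<le>
      (\<integral>\<^sup>+y. (ennreal \<bar>u y\<bar>)\<^sup>2 \<partial>lborel) * (\<integral>\<^sup>+y. (ennreal \<bar>\<phi> y\<bar>)\<^sup>2 \<partial>lborel)"
    by (rule Cauchy_Schwarz_nn_integral) auto
  also have "\<dots> \<le> ennreal (E\<^sup>2) * ennreal (B\<^sup>2)"
    using nn_integral_square_le_norm_L2[OF E] B(1)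
    by (intro mult_mono) (auto simp: ennreal_power)
  also have "\<dots> = (ennreal (B * E))\<^sup>2"
    using E0 B(2) by (simp add: ennreal_power ennreal_mult[symmetric] power_mult_distrib mult.commute)
  finally have "(\<integral>\<^sup>+y. ennreal \<bar>u y * \<phi> y\<bar> \<partial>lborel)\<^sup>2 \<le> (ennreal (B * E))\<^sup>2"
    by (simp add: abs_mult ennreal_mult)
  then have le: "(\<integral>\<^sup>+y. ennreal \<bar>u y * \<phi> y\<bar> \<partial>lborel) \<le> ennreal (B * E)"
    using E0 B(2)
    by (cases "\<integral>\<^sup>+y. ennreal \<bar>u y * \<phi> y\<bar> \<partial>lborel")
      (auto simp: ennreal_power power2_eq_square ennreal_mult_eq_top_iff top_unique
        ennreal_mult'[symmetric] abs_le_square_iff[symmetric, unfolded power2_eq_square])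
  then have "(\<integral>\<^sup>+y. ennreal (norm (u y * \<phi> y)) \<partial>lborel) < \<infinity>"
    by (simp add: le_less_trans ennreal_less_top)
  then show int: "integrable lborel (\<lambda>y. u y * \<phi> y)"
    by (intro integrableI_bounded) auto
  have "ennreal (\<integral>y. \<bar>u y * \<phi> y\<bar> \<partial>lborel) = (\<integral>\<^sup>+y. ennreal \<bar>u y * \<phi> y\<bar> \<partial>lborel)"
    using int by (intro nn_integral_eq_integral[symmetric]) auto
  then show "(\<integral>y. \<bar>u y * \<phi> y\<bar> \<partial>lborel) \<le> B * E"
    using le E0 B(2) by (metis ennreal_le_iff mult_nonneg_nonneg)
qed

section \<open>Reflection and scaling of integrals\<close>

lemma lborel_integral_reflect:
  fixes f :: "real \<Rightarrow> 'a::{banach, second_countable_topology}"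
  shows "(\<integral>y. f (x - y) \<partial>lborel) = (\<integral>y. f y \<partial>lborel)"
  by (subst lborel_integral_real_affine[of "-1" f x]) auto

lemma lborel_integrable_reflect:
  fixes f :: "real \<Rightarrow> 'a::{banach, second_countable_topology}"
  assumes "integrable lborel f"
  shows "integrable lborel (\<lambda>y. f (x - y))"
  using lborel_integrable_real_affine[OF assms, of "-1" x] by simp

lemma has_bochner_integral_scaled:
  assumes "has_bochner_integral lborel k 1" "0 < h"
  shows "has_bochner_integral lborel (scaled k h) 1"
proof -
  have "has_bochner_integral lborel (\<lambda>x. k (x / h)) h"
    using lborel_has_bochner_integral_real_affine_iff[of "1/h" k 1 0] assms
    by (simp add: field_simps)
  from has_bochner_integral_divide_zero[OF this, of h] show ?thesis
    using assms by (simp add: scaled_def[abs_def])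
qed

section \<open>Tent densities\<close>

text \<open>The triangle with centre \<open>c\<close> and half-width \<open>a\<close>, normalised to
  mass 1. Its slope is then \<open>1 / a\<^sup>2\<close>, so the Lipschitz constant limits how
  narrow it can be.\<close>

definition tent :: "real \<Rightarrow> real \<Rightarrow> real \<Rightarrow> real" where
  "tent c a x = max 0 (1 - \<bar>x - c\<bar> / a) / a"

lemma has_bochner_integral_unit_tent:
  "has_bochner_integral lborel (\<lambda>x::real. max 0 (1 - \<bar>x\<bar>)) 1"
proof -
  have l: "has_bochner_integral lborel (\<lambda>x. (1 + x) * indicator {-1..0} x) (0 + 0\<^sup>2/2 - (-1 + (-1)\<^sup>2/2 :: real))"
    by (rule has_bochner_integral_FTC_Icc_real) (auto intro!: derivative_eq_intros continuous_intros)
  have r: "has_bochner_integral lborel (\<lambda>x. (1 - x) * indicator {0..1} x) (1 - 1\<^sup>2/2 - (0 - 0\<^sup>2/2 :: real))"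
    by (rule has_bochner_integral_FTC_Icc_real) (auto intro!: derivative_eq_intros continuous_intros)
  have "has_bochner_integral lborel (\<lambda>x. (1 + x) * indicator {-1..0} x + (1 - x) * indicator {0..1} x) (1::real)"
    using has_bochner_integral_add[OF l r] by simp
  \<comment> \<open>Both halves contain the point 0, where their sum is 2 instead of 1; this is a
    null set.\<close>
  moreover have "AE x in lborel. x \<noteq> (0::real)"
    by (rule AE_lborel_singleton)
  then have "AE x::real in lborel. (1 + x) * indicator {-1..0} x + (1 - x) * indicator {0..1} x = max 0 (1 - \<bar>x\<bar>)"
    by eventually_elim (auto simp: indicator_def)
  ultimately show ?thesis
    by (subst (asm) has_bochner_integral_cong_AE[of _ lborel "\<lambda>x. max 0 (1 - \<bar>x\<bar>)"]) auto
qed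

lemma has_bochner_integral_tent:
  assumes "0 < a"
  shows "has_bochner_integral lborel (tent c a) 1"
proof -
  have "has_bochner_integral lborel (\<lambda>x. max 0 (1 - \<bar>x - c\<bar> / a)) a"
    using lborel_has_bochner_integral_real_affine_iff[of "1/a" "\<lambda>x. max 0 (1 - \<bar>x\<bar>)" 1 "-c/a"]
      has_bochner_integral_unit_tent assms
    by (simp add: diff_divide_distrib[symmetric] abs_divide field_simps)
  from has_bochner_integral_divide_zero[OF this, of a] show ?thesis
    using assms by (simp add: tent_def[abs_def])
qed

lemma tent_nonneg: "0 < a \<Longrightarrow> 0 \<le> tent c a x"
  by (simp add: tent_def)

lemma tent_eq_0: "0 < a \<Longrightarrow> a \<le> \<bar>x - c\<bar> \<Longrightarrow> tent c a x = 0"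
  by (simp add: tent_def field_simps max_def)

lemma tent_eq: "0 < a \<Longrightarrow> \<bar>x - c\<bar> \<le> a \<Longrightarrow> tent c a x = (a - \<bar>x - c\<bar>) / a\<^sup>2"
  by (simp add: tent_def field_simps max_def power2_eq_square)

lemma lipschitz_on_tent:
  assumes "0 < a"
  shows "(1 / a\<^sup>2)-lipschitz_on UNIV (tent c a)"
proof (rule lipschitz_onI)
  fix x y :: real
  have "\<bar>tent c a x - tent c a y\<bar> = \<bar>max 0 (1 - \<bar>x - c\<bar> / a) - max 0 (1 - \<bar>y - c\<bar> / a)\<bar> / a"
    using assms by (simp add: tent_def diff_divide_distrib[symmetric])
  also have "\<dots> \<le> \<bar>\<bar>x - c\<bar> / a - \<bar>y - c\<bar> / a\<bar> / a"
    using assms by (intro divide_right_mono) (linarith, simp)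
  also have "\<dots> = \<bar>\<bar>x - c\<bar> - \<bar>y - c\<bar>\<bar> / a\<^sup>2"
    using assms by (simp add: diff_divide_distrib[symmetric] power2_eq_square)
  also have "\<dots> \<le> \<bar>x - y\<bar> / a\<^sup>2"
    using assms by (intro divide_right_mono) auto
  finally show "dist (tent c a x) (tent c a y) \<le> 1 / a\<^sup>2 * dist x y"
    by (simp add: dist_real_def)
qed (use assms in auto)

lemma tent_in_lipschitz_densities:
  assumes "0 < a" "1 / a\<^sup>2 \<le> L" "\<bar>c\<bar> + a \<le> 1/2"
  shows "tent c a \<in> lipschitz_densities L"
  using assms has_bochner_integral_tent[of a c] tent_nonneg[of a c]
    lipschitz_on_le[OF lipschitz_on_tent[of a c], of L]
  by (auto simp: lipschitz_densities_def intro!: tent_eq_0)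

text \<open>Mixing does not raise the Lipschitz constant, so a full tent of arbitrarily small weight
  \<theta> can be added to a narrower one.\<close>

lemma lipschitz_densities_convex:
  assumes "f \<in> lipschitz_densities L" "g \<in> lipschitz_densities L" "0 \<le> \<theta>" "\<theta> \<le> 1"
  shows "(\<lambda>x. (1 - \<theta>) * f x + \<theta> * g x) \<in> lipschitz_densities L"
proof -
  have "has_bochner_integral lborel (\<lambda>x. (1 - \<theta>) * f x + \<theta> * g x) ((1 - \<theta>) * 1 + \<theta> * 1)"
    using assms by (intro has_bochner_integral_add has_bochner_integral_mult_right)
      (auto simp: lipschitz_densities_def)
  moreover have "L-lipschitz_on UNIV (\<lambda>x. (1 - \<theta>) * f x + \<theta> * g x)"
  proof (rule lipschitz_onI)
    fix x y :: real
    have fg: "\<bar>f x - f y\<bar> \<le> L * \<bar>x - y\<bar>" "\<bar>g x - g y\<bar> \<le> L * \<bar>x - y\<bar>"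
      using assms by (auto simp: lipschitz_densities_def lipschitz_on_def dist_real_def)
    have "\<bar>((1 - \<theta>) * f x + \<theta> * g x) - ((1 - \<theta>) * f y + \<theta> * g y)\<bar>
        = \<bar>(1 - \<theta>) * (f x - f y) + \<theta> * (g x - g y)\<bar>"
      by (simp add: algebra_simps)
    also have "\<dots> \<le> (1 - \<theta>) * \<bar>f x - f y\<bar> + \<theta> * \<bar>g x - g y\<bar>"
      using assms(3,4) by (intro order.trans[OF abs_triangle_ineq]) (simp add: abs_mult)
    also have "\<dots> \<le> (1 - \<theta>) * (L * \<bar>x - y\<bar>) + \<theta> * (L * \<bar>x - y\<bar>)"
      using assms(3,4) fg by (intro add_mono mult_left_mono) auto
    finally show "dist ((1 - \<theta>) * f x + \<theta> * g x) ((1 - \<theta>) * f y + \<theta> * g y) \<le> L * dist x y"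
      by (simp add: dist_real_def algebra_simps)
  qed (use assms(1) in \<open>auto simp: lipschitz_densities_def lipschitz_on_def\<close>)
  ultimately show ?thesis
    using assms by (auto simp: lipschitz_densities_def)
qed

section \<open>From pointwise lower bounds to the minimax risk\<close>

text \<open>Fixing \<open>f\<close> before \<open>x\<close> and \<open>I\<close> makes one density
  defeat every sample and every choice of coreset at once, so the analytic estimates involve no
  probability.\<close>

definition hard_density :: "real \<Rightarrow> (real \<Rightarrow> real) \<Rightarrow> real \<Rightarrow> nat \<Rightarrow> ennreal \<Rightarrow> (real \<Rightarrow> real) \<Rightarrow> bool" where
  "hard_density L k h m e f \<longleftrightarrow> f \<in> lipschitz_densities L \<and>
     (\<forall>x I. finite I \<longrightarrow> card I \<le> m \<longrightarrow> (\<forall>i\<in>I. x i \<in> {-1/2..1/2}) \<longrightarrow>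
       e \<le> norm_L2 (\<lambda>y. coreset_kde k h x I y - f y))"

text \<open>The supremum over densities stands inside the infimum over \<open>h\<close>, so the hard
  density may be chosen after the bandwidth. Both integrals in the risk average a quantity that is
  at least \<open>e\<close> over a probability measure.\<close>

lemma minimax_coreset_risk_ge:
  assumes "\<And>h. 0 < h \<Longrightarrow> \<exists>f. hard_density L k h m e f"
  shows "e \<le> minimax_coreset_risk k L n m"
  unfolding minimax_coreset_risk_def
proof (intro INF_greatest)
  fix h :: real and S
  assume h: "h \<in> {0<..}" and S: "S \<in> coreset_schemes n m"
  obtain f where f: "f \<in> lipschitz_densities L"
    and le: "\<And>x I. finite I \<Longrightarrow> card I \<le> m \<Longrightarrow> \<forall>i\<in>I. x i \<in> {-1/2..1/2} \<Longrightarrow>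
      e \<le> norm_L2 (\<lambda>y. coreset_kde k h x I y - f y)"
    using assms[of h] h by (auto simp: hard_density_def)
  let ?D = "density lborel (\<lambda>x. ennreal (f x))"
  have f': "\<And>x. 0 \<le> f x" "integrable lborel f" "integral\<^sup>L lborel f = 1"
    "\<And>x. x \<notin> {-1/2..1/2} \<Longrightarrow> f x = 0"
    using f by (auto simp: lipschitz_densities_def has_bochner_integral_iff)
  have [measurable]: "f \<in> borel_measurable borel"
    using borel_measurable_integrable[OF f'(2)] by simp
  have D: "prob_space ?D"
    by (rule prob_spaceI) (simp add: emeasure_density nn_integral_eq_integral f')
  have iid: "prob_space (iid_sample n f)"
    unfolding iid_sample_def by (intro prob_space_PiM D)
  \<comment> \<open>\<open>hard_density\<close> speaks only of points in \<open>{-1/2..1/2}\<close>;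
    almost every sample consists of such points.\<close>
  have "AE x in ?D. x \<in> {-1/2..1/2}"
    using f'(4) by (subst AE_density) (force intro!: AE_I2)+
  then have supp: "AE X in iid_sample n f. \<forall>i\<in>{..<n}. X i \<in> {-1/2..1/2}"
    unfolding iid_sample_def by (intro AE_finite_allI AE_PiM_component D) auto
  have sp: "space (iid_sample n f) = space (\<Pi>\<^sub>M i\<in>{..<n}. borel)"
    by (simp add: iid_sample_def space_PiM)
  have "e = (\<integral>\<^sup>+X. e \<partial>iid_sample n f)"
    using prob_space.emeasure_space_1[OF iid] by simp
  also have "\<dots> \<le> coreset_risk k n h S f"
    unfolding coreset_risk_def
  proof (rule nn_integral_mono_AE, use supp AE_space in eventually_elim)
    case (elim X)
    then have "S X \<in> space (prob_algebra (count_space {I. I \<subseteq> {..<n} \<and> card I \<le> m}))"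
      using S unfolding coreset_schemes_def sp by (auto dest: measurable_space)
    then have SX: "sets (S X) = sets (count_space {I. I \<subseteq> {..<n} \<and> card I \<le> m})" "prob_space (S X)"
      by (auto simp: space_prob_algebra)
    have "e = (\<integral>\<^sup>+I. e \<partial>S X)"
      using prob_space.emeasure_space_1[OF SX(2)] by simp
    also have "\<dots> \<le> (\<integral>\<^sup>+I. norm_L2 (\<lambda>y. coreset_kde k h X I y - f y) \<partial>S X)"
      using sets_eq_imp_space_eq[OF SX(1)] elim
      by (intro nn_integral_mono le) (auto intro: finite_subset)
    finally show ?case .
  qed
  finally show "e \<le> (SUP f\<in>lipschitz_densities L. coreset_risk k n h S f)"
    using f by (rule SUP_upper2[rotated])
qed

section \<open>Large bandwidths\<close>

text \<open>The window is kept at distance \<open>1\<close> from \<open>\<omega>\<close>, so that \<open>s - \<omega>\<close> can be divided by when a ripple of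
  frequency \<open>\<omega>\<close> is tested against it.\<close>

definition sine_window :: "real \<Rightarrow> real \<Rightarrow> real" where
  "sine_window \<omega> y = (\<integral>s. sin (s * y) * indicator {\<omega>+1..\<omega>+2} s \<partial>lborel)"

lemma borel_measurable_sine_window [measurable]: "sine_window \<omega> \<in> borel_measurable borel"
  unfolding sine_window_def[abs_def] by measurable

lemma integrable_mult_sin:
  fixes v :: "real \<Rightarrow> real"
  assumes "integrable lborel v"
  shows "integrable lborel (\<lambda>y. v y * sin (s * y))"
proof (rule Bochner_Integration.integrable_bound[OF assms])
  show "AE y in lborel. norm (v y * sin (s * y)) \<le> norm (v y)"
    by (simp add: abs_mult mult_left_le)
qed (use borel_measurable_integrable[OF assms] in measurable)

text \<open>Fubini: testing against the window averages the sine transform over frequencies. A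
  single sine is not square integrable on the line, but this average is, so an L2 error can be
  tested against it.\<close>

lemma integral_mult_sine_window:
  fixes v :: "real \<Rightarrow> real"
  assumes v: "integrable lborel v"
  shows "(\<integral>y. v y * sine_window \<omega> y \<partial>lborel) =
      (\<integral>s. (\<integral>y. v y * sin (s * y) \<partial>lborel) * indicator {\<omega>+1..\<omega>+2} s \<partial>lborel)"
    and "integrable lborel (\<lambda>s. (\<integral>y. v y * sin (s * y) \<partial>lborel) * indicator {\<omega>+1..\<omega>+2} s)"
proof -
  have [measurable]: "v \<in> borel_measurable borel"
    using borel_measurable_integrable[OF v] by simp
  let ?F = "\<lambda>(s, y). v y * sin (s * y) * indicator {\<omega>+1..\<omega>+2} s"
  have int_y: "integrable lborel (\<lambda>y. ?F (s, y))" for s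
    using integrable_mult_sin[OF v, of s] by simp
  have int: "integrable (lborel \<Otimes>\<^sub>M lborel) ?F"
  proof (rule lborel_pair.Fubini_integrable)
    show "integrable lborel (\<lambda>s. \<integral>y. norm (?F (s, y)) \<partial>lborel)"
    proof (rule Bochner_Integration.integrable_bound)
      show "integrable lborel (\<lambda>s. (\<integral>y. \<bar>v y\<bar> \<partial>lborel) * indicator {\<omega>+1..\<omega>+2} s)"
        by (intro integrable_mult_right integrable_real_indicator) auto
      show "AE s in lborel. norm (\<integral>y. norm (?F (s, y)) \<partial>lborel) \<le>
          norm ((\<integral>y. \<bar>v y\<bar> \<partial>lborel) * indicator {\<omega>+1..\<omega>+2} s)"
      proof (rule AE_I2)
        fix s
        have "(\<integral>y. norm (v y * sin (s * y)) \<partial>lborel) \<le> (\<integral>y. \<bar>v y\<bar> \<partial>lborel)"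
          using integrable_norm[OF v] integrable_norm[OF integrable_mult_sin[OF v, of s]]
          by (intro integral_mono) (simp_all add: abs_mult mult_left_le)
        then show "norm (\<integral>y. norm (?F (s, y)) \<partial>lborel) \<le>
            norm ((\<integral>y. \<bar>v y\<bar> \<partial>lborel) * indicator {\<omega>+1..\<omega>+2} s)"
          by (auto split: split_indicator simp: integral_nonneg)
      qed
    qed measurable
  qed (use int_y in auto)
  have "(\<integral>y. v y * sine_window \<omega> y \<partial>lborel) = (\<integral>y. (\<integral>s. ?F (s, y) \<partial>lborel) \<partial>lborel)"
    by (simp add: sine_window_def mult.assoc)
  also have "\<dots> = (\<integral>s. (\<integral>y. ?F (s, y) \<partial>lborel) \<partial>lborel)"
    using lborel_pair.Fubini_integral[of "\<lambda>s y. ?F (s, y)"] int by (simp add: case_prod_unfold)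
  finally show "(\<integral>y. v y * sine_window \<omega> y \<partial>lborel) =
      (\<integral>s. (\<integral>y. v y * sin (s * y) \<partial>lborel) * indicator {\<omega>+1..\<omega>+2} s \<partial>lborel)"
    by simp
  show "integrable lborel (\<lambda>s. (\<integral>y. v y * sin (s * y) \<partial>lborel) * indicator {\<omega>+1..\<omega>+2} s)"
    using lborel_pair.integrable_fst[OF int] by simp
qed

lemma abs_sine_window_le_1: "\<bar>sine_window \<omega> y\<bar> \<le> 1"
proof -
  have "\<bar>sine_window \<omega> y\<bar> \<le> (\<integral>s. \<bar>sin (s * y) * indicator {\<omega>+1..\<omega>+2} s\<bar> \<partial>lborel)"
    unfolding sine_window_def by (rule integral_abs_bound)
  also have "\<dots> \<le> (\<integral>s. indicator {\<omega>+1..\<omega>+2} s \<partial>lborel)"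
    by (rule integral_mono_AE')
       (auto simp: abs_mult split: split_indicator intro!: integrable_real_indicator)
  finally show ?thesis by simp
qed

text \<open>Integrating over the frequency gains a factor \<open>1 / \<bar>y\<bar>\<close>, the
  decay that makes the window square integrable.\<close>

lemma abs_sine_window_le:
  assumes "y \<noteq> 0"
  shows "\<bar>sine_window \<omega> y\<bar> \<le> 2 / \<bar>y\<bar>"
proof -
  have "sine_window \<omega> y = - cos ((\<omega> + 2) * y) / y - (- cos ((\<omega> + 1) * y) / y)"
    unfolding sine_window_def using assms
    by (intro integral_FTC_Icc_real) (auto intro!: derivative_eq_intros continuous_intros)
  also have "\<dots> = (cos ((\<omega> + 1) * y) - cos ((\<omega> + 2) * y)) / y"
    by (simp add: diff_divide_distrib)
  finally have "\<bar>sine_window \<omega> y\<bar> = \<bar>cos ((\<omega> + 1) * y) - cos ((\<omega> + 2) * y)\<bar> / \<bar>y\<bar>"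
    by (simp add: abs_divide)
  also have "\<dots> \<le> 2 / \<bar>y\<bar>"
    using abs_cos_le_one[of "(\<omega> + 1) * y"] abs_cos_le_one[of "(\<omega> + 2) * y"]
    by (intro divide_right_mono) linarith+
  finally show ?thesis .
qed

section \<open>The L2 norm of the window\<close>

lemma nn_integral_inverse_1_plus_square:
  "(\<integral>\<^sup>+y. ennreal (inverse (1 + y\<^sup>2)) \<partial>(lborel :: real measure)) = ennreal pi"
proof -
  have "integrable lborel (\<lambda>y::real. inverse (1 + y\<^sup>2))" "(\<integral>y. inverse (1 + y\<^sup>2) \<partial>(lborel :: real measure)) = pi"
    using integrable_inverse_1_plus_square LBINT_inverse_1_plus_square
    by (auto simp: set_integrable_def interval_lebesgue_integral_def set_lebesgue_integral_def)
  then show ?thesis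
    by (subst nn_integral_eq_integral) auto
qed

text \<open>The bounds near and away from 0 combine to \<open>8 / (1 + y\<^sup>2)\<close>, with
  integral \<open>8 * pi < 36\<close>, uniformly in \<omega>.\<close>

lemma nn_integral_sine_window_square_le:
  "(\<integral>\<^sup>+y. ennreal ((sine_window \<omega> y)\<^sup>2) \<partial>lborel) \<le> ennreal (6\<^sup>2)"
proof -
  have le: "(sine_window \<omega> y)\<^sup>2 \<le> 8 * inverse (1 + y\<^sup>2)" for y
  proof (cases "\<bar>y\<bar> \<le> 1")
    case True
    have "(sine_window \<omega> y)\<^sup>2 \<le> 1" "y\<^sup>2 \<le> 1"
      using abs_sine_window_le_1[of \<omega> y] True by (auto simp: abs_square_le_1)
    then have "(sine_window \<omega> y)\<^sup>2 * (1 + y\<^sup>2) \<le> 1 * 2"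
      by (intro mult_mono) auto
    then show ?thesis
      by (simp add: field_simps add_pos_nonneg)
  next
    case False
    have "\<bar>sine_window \<omega> y\<bar>\<^sup>2 \<le> (2 / \<bar>y\<bar>)\<^sup>2"
      using False by (intro power_mono abs_sine_window_le) auto
    then have 1: "(sine_window \<omega> y)\<^sup>2 \<le> 4 / y\<^sup>2"
      by (simp add: power_divide)
    have "1 \<le> y\<^sup>2" using False by (metis abs_square_le_1 linorder_le_cases one_power2 power2_abs)
    then have "4 / y\<^sup>2 \<le> 8 / (1 + y\<^sup>2)"
      using False by (simp add: divide_le_eq field_simps)
    with 1 show ?thesis by (simp add: divide_inverse)
  qed
  have "(\<integral>\<^sup>+y. ennreal ((sine_window \<omega> y)\<^sup>2) \<partial>lborel) \<le>
      (\<integral>\<^sup>+y. ennreal (8 * inverse (1 + y\<^sup>2)) \<partial>lborel)"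
    using le by (intro nn_integral_mono ennreal_leI)
  also have "\<dots> = (\<integral>\<^sup>+y. ennreal 8 * ennreal (inverse (1 + y\<^sup>2)) \<partial>(lborel :: real measure))"
    by (intro nn_integral_cong ennreal_mult) auto
  also have "\<dots> = ennreal (8 * pi)"
    by (simp add: nn_integral_cmult nn_integral_inverse_1_plus_square ennreal_mult)
  also have "\<dots> \<le> ennreal (6\<^sup>2)"
    using pi_less_4 by (intro ennreal_leI) simp
  finally show ?thesis .
qed

text \<open>Substituting \<open>y = x - h * t\<close> gives the imaginary part of the Fourier
  transform at \<open>h * s\<close> times a phase of modulus 1. Only the phase depends on
  \<open>x\<close>, so the bound is uniform in the position of the data point.\<close>

lemma abs_integral_scaled_sin_le:
  assumes k: "integrable lborel k" and h: "0 < h"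
  shows "\<bar>\<integral>y. scaled k h (x - y) * sin (s * y) \<partial>lborel\<bar> \<le> norm (fourier k (h * s))"
proof -
  have int: "integrable lborel (\<lambda>t. complex_of_real (k t) * iexp (- (h * s * t)))"
    by (rule Bochner_Integration.integrable_bound[OF k])
       (use borel_measurable_integrable[OF k] in \<open>auto simp: norm_mult\<close>)
  have "(\<integral>y. scaled k h (x - y) * sin (s * y) \<partial>lborel) =
      h * (\<integral>t. scaled k h (x - (x + (-h) * t)) * sin (s * (x + (-h) * t)) \<partial>lborel)"
    using h by (subst lborel_integral_real_affine[of "-h" _ x]) auto
  also have "\<dots> = (\<integral>t. k t * sin (s * x - h * s * t) \<partial>lborel)"
    using h by (simp add: scaled_def algebra_simps)
  also have "\<dots> = (\<integral>t. Im (iexp (s * x) * (complex_of_real (k t) * iexp (- (h * s * t)))) \<partial>lborel)"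
    by (intro Bochner_Integration.integral_cong)
       (simp_all add: sin_diff Re_exp Im_exp algebra_simps)
  also have "\<dots> = Im (\<integral>t. iexp (s * x) * (complex_of_real (k t) * iexp (- (h * s * t))) \<partial>lborel)"
    using int by (intro integral_Im integrable_mult_right)
  also have "\<dots> = Im (iexp (s * x) * fourier k (h * s))"
    by (simp add: fourier_def)
  also have "\<bar>\<dots>\<bar> \<le> norm (fourier k (h * s))"
    using abs_Im_le_cmod[of "iexp (s * x) * fourier k (h * s)"] by (simp add: norm_mult)
  finally show ?thesis .
qed

section \<open>Parity and elementary sine bounds\<close>

lemma integral_odd_eq_0:
  fixes v :: "real \<Rightarrow> real"
  assumes "\<And>y. v (- y) = - v y"
  shows "(\<integral>y. v y \<partial>lborel) = 0"
  using lborel_integral_reflect[of v 0] assms by simp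

lemma sin_ge_half:
  fixes z :: real
  assumes "0 \<le> z" "z \<le> 1"
  shows "z / 2 \<le> sin z"
proof -
  have "\<bar>sin z - (\<Sum>m<3. sin_coeff m * z ^ m)\<bar> \<le> inverse (fact 3) * \<bar>z\<bar> ^ 3"
    by (rule Maclaurin_sin_bound)
  then have "\<bar>sin z - z\<bar> \<le> z ^ 3 / 6"
    using assms by (simp add: sin_coeff_def numeral_3_eq_3 fact_numeral)
  then have "z - z ^ 3 / 6 \<le> sin z" by linarith
  moreover have "z ^ 3 \<le> z ^ 1"
    using assms by (intro power_decreasing) auto
  ultimately show ?thesis using assms(1) by simp
qed

lemma abs_sin_diff_le:
  fixes u v :: real
  shows "\<bar>sin u - sin v\<bar> \<le> \<bar>u - v\<bar>"
proof -
  have "\<bar>sin u - sin v\<bar> = 2 * (\<bar>sin ((u - v) / 2)\<bar> * \<bar>cos ((u + v) / 2)\<bar>)"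
    by (simp add: sin_diff_sin abs_mult)
  also have "\<dots> \<le> 2 * (\<bar>(u - v) / 2\<bar> * 1)"
    by (intro mult_left_mono mult_mono abs_sin_x_le_abs_x abs_cos_le_one) auto
  finally show ?thesis by simp
qed

text \<open>Clamping the argument instead of cutting off the sine yields the Lipschitz bound by
  composition, with constant 1 because of the division by \<omega>.\<close>

definition ripple :: "real \<Rightarrow> real \<Rightarrow> real" where
  "ripple \<omega> y = sin (\<omega> * max (- 1/4) (min (1/4) y)) / \<omega>"

lemma ripple_minus: "ripple \<omega> (- y) = - ripple \<omega> y"
proof -
  have "max (- 1/4) (min (1/4) (- y)) = - max (- 1/4) (min (1/4) y)"
    by (auto simp: max_def min_def)
  then show ?thesis by (simp add: ripple_def)
qed

context
  fixes \<omega> :: real and j :: nat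
  assumes \<omega>: "\<omega> = 4 * pi * real j" and j: "1 \<le> j"
begin

lemma frequency_ge: "12 \<le> \<omega>"
proof -
  have "12 \<le> 4 * pi * 1" using pi_gt3 by simp
  also have "\<dots> \<le> \<omega>" unfolding \<omega> using j by (intro mult_left_mono) auto
  finally show ?thesis .
qed

text \<open>Here the choice of \<omega> as a multiple of \<open>4 * pi\<close> enters: the sine
  vanishes at both ends of \<open>{-1/4..1/4}\<close>, so clamping extends it by zero.\<close>

lemma ripple_eq: "ripple \<omega> y = sin (\<omega> * y) / \<omega> * indicator {-1/4..1/4} y"
proof -
  have z: "sin (\<omega> * (1/4)) = 0" "sin (\<omega> * (- 1/4)) = 0"
    by (simp_all add: \<omega> mult.commute[of pi])
  show ?thesis
  proof (cases "y \<in> {-1/4..1/4}")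
    case True
    then show ?thesis by (simp add: ripple_def)
  next
    case False
    then have "max (- 1/4) (min (1/4) y) = 1/4 \<or> max (- 1/4) (min (1/4) y) = - 1/4"
      by auto
    then show ?thesis using z False unfolding ripple_def by auto
  qed
qed

lemma abs_ripple_le: "\<bar>ripple \<omega> y\<bar> \<le> 1 / \<omega>"
  using frequency_ge by (auto simp: ripple_def abs_divide intro!: divide_right_mono)

lemma integrable_ripple: "integrable lborel (ripple \<omega>)"
proof (rule Bochner_Integration.integrable_bound)
  show "integrable lborel (\<lambda>y. 1 / \<omega> * indicator {-1/4..1/4::real} y)"
    by (intro integrable_mult_right integrable_real_indicator) (simp_all add: less_top[symmetric])
  show "AE y in lborel. norm (ripple \<omega> y) \<le> norm (1 / \<omega> * indicator {-1/4..1/4::real} y)"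
  proof (rule AE_I2)
    fix y
    show "norm (ripple \<omega> y) \<le> norm (1 / \<omega> * indicator {-1/4..1/4::real} y)"
      using abs_ripple_le[of y] frequency_ge by (auto simp: ripple_eq split: split_indicator)
  qed
qed (simp add: ripple_def[abs_def])

text \<open>The full tent uses slope 4 and leaves \<open>L - 4\<close> for the ripple. Where the
  ripple lives the tent is at least 1, which dominates the amplitude
  \<open>(L - 4) / \<omega>\<close>; the ripple is odd, so the mass remains 1.\<close>

lemma tent_plus_ripple_in_lipschitz_densities:
  assumes L: "4 \<le> L" "L - 4 \<le> \<omega>"
  shows "(\<lambda>y. tent 0 (1/2) y + (L - 4) * ripple \<omega> y) \<in> lipschitz_densities L" (is "?f \<in> _")
proof -
  have nonneg: "0 \<le> ?f y" for y
  proof (cases "\<bar>y\<bar> \<le> 1/4")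
    case True
    have "\<bar>(L - 4) * ripple \<omega> y\<bar> \<le> \<omega> * (1 / \<omega>)"
      unfolding abs_mult using abs_ripple_le[of y] L by (intro mult_mono) auto
    then have "\<bar>(L - 4) * ripple \<omega> y\<bar> \<le> 1" using frequency_ge by simp
    moreover have "1 \<le> tent 0 (1/2) y"
      using True by (subst tent_eq) (auto simp: power2_eq_square)
    ultimately show ?thesis by linarith
  next
    case False
    then show ?thesis using tent_nonneg[of "1/2" 0 y] by (auto simp: ripple_eq split: split_indicator)
  qed
  have supp: "?f y = 0" if "y \<notin> {-1/2..1/2}" for y
  proof -
    have "tent 0 (1/2) y = 0" using that by (intro tent_eq_0) auto
    then show ?thesis using that by (auto simp: ripple_eq split: split_indicator)
  qed
  have "integral\<^sup>L lborel (ripple \<omega>) = 0"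
    by (intro integral_odd_eq_0 ripple_minus)
  then have "has_bochner_integral lborel (ripple \<omega>) 0"
    using integrable_ripple by (simp add: has_bochner_integral_iff)
  then have "has_bochner_integral lborel ?f (1 + (L - 4) * 0)"
    by (intro has_bochner_integral_add has_bochner_integral_mult_right has_bochner_integral_tent) auto
  moreover have "L-lipschitz_on UNIV ?f"
  proof (rule lipschitz_onI)
    fix x y :: real
    have "\<bar>tent 0 (1/2) x - tent 0 (1/2) y\<bar> \<le> 4 * \<bar>x - y\<bar>"
      using lipschitz_onD[OF lipschitz_on_tent[of "1/2" 0], of x y]
      by (simp add: dist_real_def power2_eq_square)
    moreover have "\<bar>ripple \<omega> x - ripple \<omega> y\<bar> \<le> \<bar>x - y\<bar>"
    proof -
      let ?cl = "\<lambda>y::real. max (- 1/4) (min (1/4) y)"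
      have "\<bar>sin (\<omega> * ?cl x) - sin (\<omega> * ?cl y)\<bar> \<le> \<bar>\<omega> * ?cl x - \<omega> * ?cl y\<bar>"
        by (rule abs_sin_diff_le)
      also have "\<dots> = \<omega> * \<bar>?cl x - ?cl y\<bar>"
        using frequency_ge by (simp add: abs_mult flip: right_diff_distrib)
      also have "\<dots> \<le> \<omega> * \<bar>x - y\<bar>"
        using frequency_ge by (intro mult_left_mono) (auto simp: max_def min_def)
      finally show ?thesis
        using frequency_ge by (simp add: ripple_def field_simps flip: diff_divide_distrib)
    qed
    then have "(L - 4) * \<bar>ripple \<omega> x - ripple \<omega> y\<bar> \<le> (L - 4) * \<bar>x - y\<bar>"
      using L by (intro mult_left_mono) auto
    moreover have "\<bar>?f x - ?f y\<bar> \<le> \<bar>tent 0 (1/2) x - tent 0 (1/2) y\<bar> + (L - 4) * \<bar>ripple \<omega> x - ripple \<omega> y\<bar>"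
    proof -
      have "?f x - ?f y = (tent 0 (1/2) x - tent 0 (1/2) y) + (L - 4) * (ripple \<omega> x - ripple \<omega> y)"
        by (simp add: algebra_simps)
      then have "\<bar>?f x - ?f y\<bar> \<le> \<bar>tent 0 (1/2) x - tent 0 (1/2) y\<bar> + \<bar>(L - 4) * (ripple \<omega> x - ripple \<omega> y)\<bar>"
        by (metis abs_triangle_ineq)
      then show ?thesis using L by (simp add: abs_mult)
    qed
    ultimately show "dist (?f x) (?f y) \<le> L * dist x y"
      by (simp add: dist_real_def algebra_simps)
  qed (use L in auto)
  ultimately show ?thesis
    using nonneg supp by (auto simp: lipschitz_densities_def)
qed

text \<open>The product of sines splits into a resonant term of frequency
  \<open>s - \<omega>\<close>, between 1 and 2, and a term of frequency \<open>s + \<omega>\<close>,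
  at least 24. They contribute at least 1/8 and at most 1/24, and the difference exceeds
  1/16.\<close>

lemma integral_ripple_sin_ge:
  assumes s: "\<omega> + 1 \<le> s" "s \<le> \<omega> + 2"
  shows "1 / (16 * \<omega>) \<le> (\<integral>y. ripple \<omega> y * sin (s * y) \<partial>lborel)"
proof -
  define F where "F y = (sin ((s - \<omega>) * y) / (s - \<omega>) - sin ((s + \<omega>) * y) / (s + \<omega>)) / 2" for y
  note w = frequency_ge
  have "(\<integral>y. sin (\<omega> * y) * sin (s * y) * indicator {-1/4..1/4} y \<partial>lborel) = F (1/4) - F (- 1/4)"
  proof (rule integral_FTC_Icc_real)
    fix y :: real
    have "(F has_real_derivative (cos ((s - \<omega>) * y) - cos ((s + \<omega>) * y)) / 2) (at y)"
      unfolding F_def[abs_def] using s w by (auto intro!: derivative_eq_intros)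
    also have "(cos ((s - \<omega>) * y) - cos ((s + \<omega>) * y)) / 2 = sin (\<omega> * y) * sin (s * y)"
      by (simp add: cos_add cos_diff algebra_simps)
    finally show "(F has_real_derivative sin (\<omega> * y) * sin (s * y)) (at y)" .
  qed (auto intro!: continuous_intros)
  also have "\<dots> = sin ((s - \<omega>) / 4) / (s - \<omega>) - sin ((s + \<omega>) / 4) / (s + \<omega>)"
  proof -
    have "F (- y) = - F y" for y by (simp add: F_def diff_divide_distrib)
    from this[of "1/4"] have "F (- 1/4) = - F (1/4)" by simp
    moreover have "F (1/4) = (sin ((s - \<omega>) / 4) / (s - \<omega>) - sin ((s + \<omega>) / 4) / (s + \<omega>)) / 2"
      by (simp add: F_def)
    ultimately show ?thesis by (metis diff_minus_eq_add field_sum_of_halves)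
  qed
  also have "\<dots> \<ge> 1/8 - 1/24"
  proof (intro diff_mono)
    have "(s - \<omega>) / 4 / 2 \<le> sin ((s - \<omega>) / 4)"
      using s by (intro sin_ge_half) auto
    then show "1/8 \<le> sin ((s - \<omega>) / 4) / (s - \<omega>)"
      using s by (simp add: field_simps)
    have "sin ((s + \<omega>) / 4) / (s + \<omega>) \<le> 1 / (s + \<omega>)"
      using s w by (intro divide_right_mono) auto
    also have "\<dots> \<le> 1 / 24"
      using s w by (intro divide_left_mono) auto
    finally show "sin ((s + \<omega>) / 4) / (s + \<omega>) \<le> 1 / 24" .
  qed
  finally have "1 / 16 \<le> (\<integral>y. sin (\<omega> * y) * sin (s * y) * indicator {-1/4..1/4} y \<partial>lborel)"
    by simp
  then have "1 / 16 / \<omega> \<le> (\<integral>y. sin (\<omega> * y) * sin (s * y) * indicator {-1/4..1/4} y \<partial>lborel) / \<omega>"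
    using w by (intro divide_right_mono) auto
  also have "\<dots> = (\<integral>y. sin (\<omega> * y) * sin (s * y) * indicator {-1/4..1/4} y / \<omega> \<partial>lborel)"
    by simp
  also have "\<dots> = (\<integral>y. ripple \<omega> y * sin (s * y) \<partial>lborel)"
    by (intro Bochner_Integration.integral_cong) (simp_all add: ripple_eq algebra_simps)
  finally show ?thesis by simp
qed

text \<open>On the window the sine transform of the density is at least
  \<open>(L - 4) / (16 * \<omega>)\<close>, twice what the estimator \<open>g\<close> can reach. The
  missing half is at most 6 times the L2 error, 6 being the bound for the norm of the window; the
  constant 384 is twice \<open>6 * 32\<close>, which leaves a strict contradiction.\<close>

lemma oscillation_lower_bound:
  assumes L: "4 < L" "L - 4 \<le> \<omega>"
    and g: "integrable lborel g"
      "\<And>s. s \<in> {\<omega>+1..\<omega>+2} \<Longrightarrow> \<bar>\<integral>y. g y * sin (s * y) \<partial>lborel\<bar> \<le> (L - 4) / (32 * \<omega>)"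
  shows "ennreal ((L - 4) / (384 * \<omega>)) \<le> norm_L2 (\<lambda>y. g y - (tent 0 (1/2) y + (L - 4) * ripple \<omega> y))"
proof (rule ccontr)
  define f where "f y = tent 0 (1/2) y + (L - 4) * ripple \<omega> y" for y
  let ?c = "(L - 4) / (384 * \<omega>)"
  assume "\<not> ?thesis"
  then have less: "norm_L2 (\<lambda>y. f y - g y) < ennreal ?c"
    by (simp add: f_def not_le norm_L2_def power2_commute[of "g _"])
  have T: "integrable lborel (tent 0 (1/2))"
    using has_bochner_integral_tent[of "1/2" 0] by (simp add: has_bochner_integral_iff)
  have f: "integrable lborel f"
    unfolding f_def[abs_def] using T integrable_ripple by simp
  have [measurable]: "f \<in> borel_measurable borel" "g \<in> borel_measurable borel"
    using borel_measurable_integrable[OF f] borel_measurable_integrable[OF g(1)] by simp_all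
  have fs: "(L - 4) / (16 * \<omega>) \<le> (\<integral>y. f y * sin (s * y) \<partial>lborel)" if s: "s \<in> {\<omega>+1..\<omega>+2}" for s
  proof -
    have "(L - 4) / (16 * \<omega>) = (L - 4) * (1 / (16 * \<omega>))" by simp
    also have "\<dots> \<le> (L - 4) * (\<integral>y. ripple \<omega> y * sin (s * y) \<partial>lborel)"
      using L s integral_ripple_sin_ge[of s] by (intro mult_left_mono) auto
    \<comment> \<open>The tent is even, so its sine transform vanishes and only the ripple is
      seen.\<close>
    also have "\<dots> = (\<integral>y. tent 0 (1/2) y * sin (s * y) \<partial>lborel) + (\<integral>y. (L - 4) * (ripple \<omega> y * sin (s * y)) \<partial>lborel)"
      using integral_odd_eq_0[of "\<lambda>y. tent 0 (1/2) y * sin (s * y)"] by (simp add: tent_def)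
    also have "\<dots> = (\<integral>y. tent 0 (1/2) y * sin (s * y) + (L - 4) * (ripple \<omega> y * sin (s * y)) \<partial>lborel)"
      by (intro Bochner_Integration.integral_add[symmetric] integrable_mult_right integrable_mult_sin T integrable_ripple)
    also have "\<dots> = (\<integral>y. f y * sin (s * y) \<partial>lborel)"
      by (simp add: f_def algebra_simps)
    finally show ?thesis .
  qed
  have fg: "integrable lborel (\<lambda>y. f y - g y)" using f g(1) by simp
  have "(L - 4) / (32 * \<omega>) \<le> (\<integral>y. (f y - g y) * sin (s * y) \<partial>lborel)" if s: "s \<in> {\<omega>+1..\<omega>+2}" for s
  proof -
    have "(\<integral>y. (f y - g y) * sin (s * y) \<partial>lborel) =
        (\<integral>y. f y * sin (s * y) \<partial>lborel) - (\<integral>y. g y * sin (s * y) \<partial>lborel)"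
      using integrable_mult_sin[OF f, of s] integrable_mult_sin[OF g(1), of s]
      by (simp add: left_diff_distrib)
    moreover have "(L - 4) / (16 * \<omega>) = 2 * ((L - 4) / (32 * \<omega>))"
      using frequency_ge by (simp add: divide_eq_eq eq_divide_eq)
    ultimately show ?thesis using fs[OF s] g(2)[OF s] by linarith
  qed
  then have "(\<integral>s. (L - 4) / (32 * \<omega>) * indicator {\<omega>+1..\<omega>+2} s \<partial>lborel) \<le>
      (\<integral>s. (\<integral>y. (f y - g y) * sin (s * y) \<partial>lborel) * indicator {\<omega>+1..\<omega>+2} s \<partial>lborel)"
    by (intro integral_mono integral_mult_sine_window(2)[OF fg] integrable_mult_right integrable_real_indicator)
       (auto split: split_indicator)
  then have "(L - 4) / (32 * \<omega>) \<le> (\<integral>y. (f y - g y) * sine_window \<omega> y \<partial>lborel)"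
    using integral_mult_sine_window(1)[OF fg, of \<omega>] by simp
  also have "\<dots> \<le> (\<integral>y. \<bar>(f y - g y) * sine_window \<omega> y\<bar> \<partial>lborel)"
    using integral_abs_bound[of lborel "\<lambda>y. (f y - g y) * sine_window \<omega> y"] by linarith
  also have "\<dots> \<le> 6 * ?c"
    by (rule integral_abs_mult_le(2)[OF _ _ less nn_integral_sine_window_square_le]) auto
  finally show False
    using L frequency_ge by (simp add: divide_le_cancel field_simps)
qed

end

section \<open>Sine transform of the coreset estimator\<close>

lemma integrable_coreset_kde:
  assumes "integrable lborel k" "0 < h"
  shows "integrable lborel (coreset_kde k h x I)"
proof -
  have "integrable lborel (\<lambda>u. scaled k h u)"
    using lborel_integrable_real_affine[OF assms(1), of "1/h" 0] assms(2) by (simp add: scaled_def)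
  from lborel_integrable_reflect[OF this] show ?thesis
    unfolding coreset_kde_def[abs_def] by (intro integrable_mult_right Bochner_Integration.integrable_sum)
qed

text \<open>Equal weights summing to 1 preserve a bound that is uniform in the points. The premise
  on \<open>fourier k\<close> is conditional on \<open>I \<noteq> {}\<close> because the empty
  coreset gives the zero function, which serves the case \<open>m = 0\<close> at every
  bandwidth.\<close>

lemma coreset_kde_sin_le:
  assumes k: "integrable lborel k" "0 < h"
    and b: "0 \<le> b" "I \<noteq> {} \<Longrightarrow> norm (fourier k (h * s)) \<le> b"
  shows "\<bar>\<integral>y. coreset_kde k h x I y * sin (s * y) \<partial>lborel\<bar> \<le> b"
proof -
  let ?w = "1 / real (card I)"
  have "integrable lborel (\<lambda>u. scaled k h u)"
    using lborel_integrable_real_affine[OF k(1), of "1/h" 0] k(2) by (simp add: scaled_def)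
  then have int: "integrable lborel (\<lambda>y. scaled k h (x i - y) * sin (s * y))" for i
    by (intro integrable_mult_sin lborel_integrable_reflect)
  have "(\<integral>y. coreset_kde k h x I y * sin (s * y) \<partial>lborel) =
      ?w * (\<Sum>i\<in>I. \<integral>y. scaled k h (x i - y) * sin (s * y) \<partial>lborel)"
    using int by (simp add: coreset_kde_def sum_distrib_right mult.assoc)
  also have "\<bar>\<dots>\<bar> \<le> ?w * (\<Sum>i\<in>I. \<bar>\<integral>y. scaled k h (x i - y) * sin (s * y) \<partial>lborel\<bar>)"
    by (simp add: abs_mult divide_right_mono)
  also have "\<dots> \<le> ?w * (\<Sum>i\<in>I. b)"
    using b abs_integral_scaled_sin_le[OF k, of _ s]
    by (intro mult_left_mono sum_mono) (auto intro: order.trans)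
  also have "\<dots> \<le> b" using b(1) by simp
  finally show ?thesis .
qed

text \<open>For frequencies \<open>s \<ge> N\<close> the bandwidth condition gives
  \<open>h * s \<ge> N powr (2 / l)\<close>, so the Fourier decay bounds the estimator by
  \<open>C / N\<^sup>2\<close>, eventually below the ripple, which is of order
  \<open>1 / N\<close>.\<close>

lemma large_bandwidth_lower_bound:
  assumes k: "integrable lborel k" and l: "0 < l" and L: "4 < L"
    and F: "(\<lambda>\<omega>. norm (fourier k \<omega>)) \<in> O[at_infinity](\<lambda>\<omega>. \<bar>\<omega>\<bar> powr (- l))"
  shows "\<exists>c>0. \<forall>\<^sub>F N in at_top. \<forall>h>0. \<forall>m::nat. m = 0 \<or> N powr (- 1 + 2 / l) \<le> h \<longrightarrow>
    (\<exists>f. hard_density L k h m (ennreal (c / N)) f)"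
proof -
  obtain C where C: "0 < C" and "\<forall>\<^sub>F \<omega> in at_infinity. norm (norm (fourier k \<omega>)) \<le> C * norm (\<bar>\<omega>\<bar> powr (- l))"
    using F by (elim landau_o.bigE)
  then obtain W where W: "\<And>\<omega>. W \<le> \<bar>\<omega>\<bar> \<Longrightarrow> norm (fourier k \<omega>) \<le> C * \<bar>\<omega>\<bar> powr (- l)"
    by (auto simp: eventually_at_infinity)
  \<comment> \<open>The constant of \<open>oscillation_lower_bound\<close>, with a further 32
    because \<omega> will be at most \<open>32 * N\<close>.\<close>
  define c where "c = (L - 4) / (384 * 32)"
  have "0 < c" using L by (simp add: c_def)
  moreover have "\<forall>\<^sub>F N in at_top. W \<le> N powr (2 / l)"
    using l by (intro filterlim_at_top[THEN iffD1, rule_format] real_powr_at_top) auto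
  then have "\<forall>\<^sub>F N in at_top. \<forall>h>0. \<forall>m::nat. m = 0 \<or> N powr (- 1 + 2 / l) \<le> h \<longrightarrow>
    (\<exists>f. hard_density L k h m (ennreal (c / N)) f)"
    \<comment> \<open>The second threshold ensures \<open>L - 4 \<le> \<omega>\<close>, the third
      \<open>C / N\<^sup>2 \<le> (L - 4) / (32 * (32 * N))\<close>.\<close>
    using eventually_ge_at_top[of 1] eventually_ge_at_top[of "L - 4"]
      eventually_ge_at_top[of "1024 * C / (L - 4)"]
  proof eventually_elim
    case (elim N)
    \<comment> \<open>Rounding up gives an admissible frequency between \<open>N\<close> and
      \<open>32 * N\<close>.\<close>
    define j where "j = nat \<lceil>N\<rceil>"
    define \<omega> where "\<omega> = 4 * pi * real j"
    have j: "1 \<le> j" "N \<le> real j" "real j \<le> 2 * N"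
      using elim(2) by (auto simp: j_def; linarith)+
    have "N = 1 * N" by simp
    also have "\<dots> \<le> (4 * pi) * j" using j elim(2) pi_gt3 by (intro mult_mono) auto
    finally have \<omega>1: "N \<le> \<omega>" by (simp add: \<omega>_def)
    have "4 * pi * j \<le> 16 * (2 * N)" using j elim(2) pi_less_4 by (intro mult_mono) auto
    then have \<omega>2: "\<omega> \<le> 32 * N" by (simp add: \<omega>_def)
    have small: "C / N\<^sup>2 \<le> (L - 4) / (32 * \<omega>)"
    proof -
      have "C / N\<^sup>2 \<le> (L - 4) / (32 * (32 * N))"
        using elim(2,4) L by (simp add: field_simps power2_eq_square)
      also have "\<dots> \<le> (L - 4) / (32 * \<omega>)"
        using \<omega>1 \<omega>2 elim(2) L by (intro divide_left_mono) auto
      finally show ?thesis .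
    qed
    show ?case
    proof (intro allI impI)
      fix h :: real and m :: nat
      assume h: "0 < h" and hm: "m = 0 \<or> N powr (- 1 + 2 / l) \<le> h"
      let ?f = "\<lambda>y. tent 0 (1/2) y + (L - 4) * ripple \<omega> y"
      show "\<exists>f. hard_density L k h m (ennreal (c / N)) f"
      proof (rule exI[of _ ?f], unfold hard_density_def, intro conjI allI impI)
        show "?f \<in> lipschitz_densities L"
          using L elim(3) \<omega>1 by (intro tent_plus_ripple_in_lipschitz_densities[OF \<omega>_def j(1)]) auto
        fix x :: "nat \<Rightarrow> real" and I :: "nat set"
        assume I: "finite I" "card I \<le> m"
        have "ennreal (c / N) \<le> ennreal ((L - 4) / (384 * \<omega>))"
        proof (rule ennreal_leI)
          have "c / N = (L - 4) / (384 * (32 * N))" by (simp add: c_def)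
          also have "\<dots> \<le> (L - 4) / (384 * \<omega>)"
            using \<omega>1 \<omega>2 elim(2) L by (intro divide_left_mono) auto
          finally show "c / N \<le> (L - 4) / (384 * \<omega>)" .
        qed
        also have "\<dots> \<le> norm_L2 (\<lambda>y. coreset_kde k h x I y - ?f y)"
        proof (rule oscillation_lower_bound[OF \<omega>_def j(1) L])
          fix s assume s: "s \<in> {\<omega> + 1..\<omega> + 2}"
          show "\<bar>\<integral>y. coreset_kde k h x I y * sin (s * y) \<partial>lborel\<bar> \<le> (L - 4) / (32 * \<omega>)"
          proof (rule coreset_kde_sin_le[OF k h])
            show "0 \<le> (L - 4) / (32 * \<omega>)" using L \<omega>1 elim(2) by simp
            assume "I \<noteq> {}"
            then have hN: "N powr (- 1 + 2 / l) \<le> h" using hm I by auto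
            have "N powr (2 / l) = N powr (- 1 + 2 / l) * N"
              using powr_add[of N "- 1 + 2 / l" 1] elim(2) by simp
            also have "\<dots> \<le> h * s"
              using hN s \<omega>1 elim(2) h by (intro mult_mono) auto
            finally have hs: "N powr (2 / l) \<le> h * s" .
            have pos: "0 < N powr (2 / l)" using elim(2) by simp
            have "norm (fourier k (h * s)) \<le> C * \<bar>h * s\<bar> powr (- l)"
              using hs elim(1) by (intro W) auto
            also have "\<dots> \<le> C * (N powr (2 / l)) powr (- l)"
              using hs pos C l by (intro mult_left_mono powr_mono2') auto
            also have "\<dots> = C / N\<^sup>2"
              using l elim(2) by (simp add: powr_powr powr_minus_divide)
            also note small
            finally show "norm (fourier k (h * s)) \<le> (L - 4) / (32 * \<omega>)" .
          qed
        qed (use elim(3) \<omega>1 integrable_coreset_kde[OF k h] in auto)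
        finally show "ennreal (c / N) \<le> norm_L2 (\<lambda>y. coreset_kde k h x I y - ?f y)" .
      qed
    qed
  qed
  ultimately show ?thesis by blast
qed

section \<open>Small bandwidths\<close>

text \<open>After the reflection \<open>t = x - y\<close> this is monotonicity in the window: the
  mass that a point sends into \<open>A\<close> is compared with a kernel mass over displacements
  that is the same for all points.\<close>

lemma integral_window_le:
  fixes H :: "real \<Rightarrow> real"
  assumes H: "integrable lborel H" "\<And>t. 0 \<le> H t"
    and AB: "A \<in> sets borel" "B \<in> sets borel" "\<And>y. y \<in> A \<Longrightarrow> x - y \<in> B"
  shows "(\<integral>y. H (x - y) * indicator A y \<partial>lborel) \<le> (\<integral>t. H t * indicator B t \<partial>lborel)"
proof -
  have "(\<integral>y. H (x - y) * indicator A y \<partial>lborel) \<le> (\<integral>y. H (x - y) * indicator B (x - y) \<partial>lborel)"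
    using H AB lborel_integrable_reflect[OF H(1), of x]
      lborel_integrable_reflect[OF integrable_real_mult_indicator[OF _ H(1)], of B x]
    by (intro integral_mono) (auto split: split_indicator intro!: integrable_real_mult_indicator)
  then show ?thesis
    by (simp add: lborel_integral_reflect[of "\<lambda>t. H t * indicator B t" x])
qed

lemma integral_window_ge:
  fixes H :: "real \<Rightarrow> real"
  assumes H: "integrable lborel H" "\<And>t. 0 \<le> H t"
    and AB: "A \<in> sets borel" "B \<in> sets borel" "\<And>t. t \<in> B \<Longrightarrow> x - t \<in> A"
  shows "(\<integral>t. H t * indicator B t \<partial>lborel) \<le> (\<integral>y. H (x - y) * indicator A y \<partial>lborel)"
proof -
  have "(\<integral>y. H (x - y) * indicator B (x - y) \<partial>lborel) \<le> (\<integral>y. H (x - y) * indicator A y \<partial>lborel)"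
    using H AB(1,2) AB(3)[of "x - y" for y] lborel_integrable_reflect[OF H(1), of x]
      lborel_integrable_reflect[OF integrable_real_mult_indicator[OF _ H(1)], of B x]
    by (intro integral_mono) (auto split: split_indicator intro!: integrable_real_mult_indicator)
  then show ?thesis
    by (simp add: lborel_integral_reflect[of "\<lambda>t. H t * indicator B t" x])
qed

section \<open>Integrals over short intervals\<close>

lemma real_integral_ge_const_interval:
  fixes f :: "real \<Rightarrow> real"
  assumes "integrable lborel f" "\<And>x. 0 \<le> f x" "\<And>x. x \<in> {u..v} \<Longrightarrow> c \<le> f x" "u \<le> v" "{u..v} \<subseteq> A" "A \<in> sets borel"
  shows "c * (v - u) \<le> (\<integral>x. f x * indicator A x \<partial>lborel)"
proof -
  have "(\<integral>x. c * indicator {u..v} x \<partial>lborel) \<le> (\<integral>x. f x * indicator A x \<partial>lborel)"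
    using assms by (intro integral_mono) (auto split: split_indicator intro!: integrable_real_mult_indicator)
  then show ?thesis using assms(4) by simp
qed

text \<open>Cauchy-Schwarz against the indicator of an interval of length at most 1, whose L2 norm
  is at most 1.\<close>

lemma
  fixes f g :: "real \<Rightarrow> real"
  assumes [measurable]: "f \<in> borel_measurable borel" "g \<in> borel_measurable borel"
    and E: "norm_L2 (\<lambda>y. g y - f y) < ennreal E" and uv: "u \<le> v" "v \<le> u + 1"
  shows integrable_L2_diff_interval: "integrable lborel (\<lambda>y. \<bar>g y - f y\<bar> * indicator {u..v} y)"
    and integral_L2_diff_interval_le: "(\<integral>y. \<bar>g y - f y\<bar> * indicator {u..v} y \<partial>lborel) \<le> E"
proof -
  have "(\<integral>\<^sup>+y. ennreal ((indicator {u..v} y)\<^sup>2) \<partial>lborel) = (\<integral>\<^sup>+y. indicator {u..v} y \<partial>lborel)"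
    by (intro nn_integral_cong) (simp add: indicator_def)
  also have "\<dots> \<le> ennreal (1\<^sup>2)"
    using uv by (simp add: ennreal_leI)
  finally have B: "(\<integral>\<^sup>+y. ennreal ((indicator {u..v} y)\<^sup>2) \<partial>lborel) \<le> ennreal (1\<^sup>2)" .
  have "\<bar>(g y - f y) * indicator {u..v} y\<bar> = \<bar>g y - f y\<bar> * indicator {u..v} y" for y
    by (simp add: abs_mult)
  then show "integrable lborel (\<lambda>y. \<bar>g y - f y\<bar> * indicator {u..v} y)"
    "(\<integral>y. \<bar>g y - f y\<bar> * indicator {u..v} y \<partial>lborel) \<le> E"
    using integrable_abs[OF integral_abs_mult_le(1)[OF _ _ E B]] integral_abs_mult_le(2)[OF _ _ E B]
    by auto
qed

text \<open>The left tent ends at \<open>1/2 - 4 * d\<close>, so the gap has length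
  \<open>4 * d\<close>. \<open>H\<close> is the scaled kernel, \<rho> the radius of its core and
  \<open>M\<close> the budget. An error below the claimed bound forces, by comparing masses on
  intervals, a positive weight of points at the left end, then a small tail \<tau>, and a weight of
  order \<theta> near the gap; together these cannot supply the mass of the density on the
  gap.\<close>

lemma plateau_lower_bound:
  fixes H :: "real \<Rightarrow> real" and x :: "'i \<Rightarrow> real"
  assumes H: "has_bochner_integral lborel H 1" "\<And>t. 0 \<le> H t" "\<And>t. H (- t) = H t"
    and a: "1/4 < a" "a < 1/2" and d: "d = (1 - 2 * a) / 4"
    and \<theta>: "0 < \<theta>" "\<theta> \<le> 1/4"
    and x: "\<And>i. i \<in> I \<Longrightarrow> x i \<in> {-1/2..1/2}"
    and I: "finite I" "card I \<le> M"
    and \<rho>: "0 \<le> \<rho>" "\<rho> \<le> d / 2" "4 * \<theta> * M * \<rho> \<le> d\<^sup>2 / 4"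
    and \<eta>: "(\<integral>t. H t * indicator {t. \<rho> < \<bar>t\<bar>} t \<partial>lborel) \<le> d\<^sup>2 / 32"
  shows "ennreal (\<theta> * d ^ 4 / 8) \<le> norm_L2 (\<lambda>y. (1 / real (card I)) * (\<Sum>i\<in>I. H (x i - y)) -
    ((1 - \<theta>) * tent (a - 1/2) a y + \<theta> * tent 0 (1/2) y))"
proof (rule ccontr)
  \<comment> \<open>The fourth power of \<open>d\<close> is chosen so that
    \<open>8 * E / d\<^sup>2 = \<theta> * d\<^sup>2\<close>, the bound obtained for \<tau>
    below.\<close>
  define E where "E = \<theta> * d ^ 4 / 8"
  define f where "f y = (1 - \<theta>) * tent (a - 1/2) a y + \<theta> * tent 0 (1/2) y" for y
  define w where "w = 1 / real (card I)"
  define g where "g y = w * (\<Sum>i\<in>I. H (x i - y))" for y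
  define \<eta> where "\<eta> = (\<integral>t. H t * indicator {t. \<rho> < \<bar>t\<bar>} t \<partial>lborel)"
  \<comment> \<open>Displacements between \<open>d\<close> and 1 serve both ends: from points within
    \<open>d\<close> of -1/2 they lead to \<open>{-3/2..-1/2}\<close>, and points left of
    \<open>1/2 - 3 * d\<close> reach \<open>{1/2 - 2 * d..1/2}\<close> only by their mirror
    images.\<close>
  define \<tau> where "\<tau> = (\<integral>t. H t * indicator {d..1} t \<partial>lborel)"
  assume "\<not> ?thesis"
  then have less: "norm_L2 (\<lambda>y. g y - f y) < ennreal E"
    by (simp add: E_def f_def g_def w_def not_le)
  have d0: "0 < d" "d < 1/8" using a d by auto
  have Hint: "integrable lborel H" "(\<integral>t. H t \<partial>lborel) = 1"
    using H(1) by (auto simp: has_bochner_integral_iff)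
  have [measurable]: "H \<in> borel_measurable borel"
    using borel_measurable_integrable[OF Hint(1)] by simp
  have Hx: "integrable lborel (\<lambda>y. H (u - y))" for u
    by (rule lborel_integrable_reflect[OF Hint(1)])
  have HxA: "integrable lborel (\<lambda>y. H (u - y) * indicator A y)" if "A \<in> sets borel" for u A
    using Hx that by (intro integrable_real_mult_indicator) auto
  have HA: "integrable lborel (\<lambda>y. H y * indicator A y)" if "A \<in> sets borel" for A
    using Hint that by (intro integrable_real_mult_indicator) auto
  have fd: "integrable lborel f"
    using has_bochner_integral_tent[of a "a - 1/2"] has_bochner_integral_tent[of "1/2" 0] a
    by (auto simp: f_def[abs_def] has_bochner_integral_iff)
  have [measurable]: "f \<in> borel_measurable borel"
    using borel_measurable_integrable[OF fd] by simp
  have [measurable]: "g \<in> borel_measurable borel"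
    by (simp add: g_def[abs_def])
  have f0: "0 \<le> f y" for y
    using a \<theta> tent_nonneg[of a "a-1/2" y] tent_nonneg[of "1/2" 0 y] by (simp add: f_def)
  have w0: "0 \<le> w" by (simp add: w_def)
  have wsum: "w * (\<Sum>i\<in>I. c) \<le> c" if "0 \<le> c" for c :: real
    using that I by (simp add: w_def)
  have wsum0: "w * (\<Sum>i\<in>I. u i) \<le> w * (\<Sum>i\<in>I. v i)" if "\<And>i. i \<in> I \<Longrightarrow> u i \<le> v i" for u v :: "'i \<Rightarrow> real"
    using that w0 by (intro mult_left_mono sum_mono) auto
  have intg: "(\<integral>y. g y * indicator A y \<partial>lborel) = w * (\<Sum>i\<in>I. \<integral>y. H (x i - y) * indicator A y \<partial>lborel)"
    if "A \<in> sets borel" for A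
    using HxA[OF that] by (simp add: g_def sum_distrib_right mult.assoc)
  have gA: "integrable lborel (\<lambda>y. g y * indicator A y)" if "A \<in> sets borel" for A
    using HxA[OF that] by (simp add: g_def[abs_def] sum_distrib_right mult.assoc)
  have fA: "integrable lborel (\<lambda>y. f y * indicator A y)" if "A \<in> sets borel" for A
    using fd that by (intro integrable_real_mult_indicator) auto
  note D = integrable_L2_diff_interval[OF _ _ less] integral_L2_diff_interval_le[OF _ _ less]
  have gf: "(\<integral>y. g y * indicator {u..v} y \<partial>lborel) \<le> (\<integral>y. f y * indicator {u..v} y \<partial>lborel) + E"
    if "u \<le> v" "v \<le> u + 1" for u v
  proof -
    have "(\<integral>y. g y * indicator {u..v} y \<partial>lborel) \<le>
        (\<integral>y. f y * indicator {u..v} y + \<bar>g y - f y\<bar> * indicator {u..v} y \<partial>lborel)"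
      using gA fA D(1) that by (intro integral_mono Bochner_Integration.integrable_add) (auto split: split_indicator)
    also have "\<dots> = (\<integral>y. f y * indicator {u..v} y \<partial>lborel) + (\<integral>y. \<bar>g y - f y\<bar> * indicator {u..v} y \<partial>lborel)"
      using gA fA D(1) that by (intro Bochner_Integration.integral_add) auto
    finally show ?thesis using D(2)[of u v] that by simp
  qed
  have fg: "(\<integral>y. f y * indicator {u..v} y \<partial>lborel) \<le> (\<integral>y. g y * indicator {u..v} y \<partial>lborel) + E"
    if "u \<le> v" "v \<le> u + 1" for u v
  proof -
    have "(\<integral>y. f y * indicator {u..v} y \<partial>lborel) \<le>
        (\<integral>y. g y * indicator {u..v} y + \<bar>g y - f y\<bar> * indicator {u..v} y \<partial>lborel)"
      using gA fA D(1) that by (intro integral_mono Bochner_Integration.integrable_add) (auto split: split_indicator)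
    also have "\<dots> = (\<integral>y. g y * indicator {u..v} y \<partial>lborel) + (\<integral>y. \<bar>g y - f y\<bar> * indicator {u..v} y \<partial>lborel)"
      using gA fA D(1) that by (intro Bochner_Integration.integral_add) auto
    finally show ?thesis using D(2)[of u v] that by simp
  qed
  have f_gap: "f y = \<theta> * tent 0 (1/2) y" if "1/2 - 4 * d \<le> y" for y
  proof -
    have "a \<le> \<bar>y - (a - 1/2)\<bar>" using that d abs_ge_self[of "y - (a - 1/2)"] by (simp add: field_simps)
    then show ?thesis using a by (simp add: f_def tent_eq_0)
  qed
  have f_out: "f y = 0" if "y \<le> -1/2 \<or> 1/2 \<le> y" for y
  proof -
    have "a \<le> \<bar>y - (a - 1/2)\<bar>" "1/2 \<le> \<bar>y - 0\<bar>" using that a by (auto simp: abs_if)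
    then show ?thesis using a by (simp add: f_def tent_eq_0)
  qed
  have f_le: "f y \<le> 2 * \<theta>" if "1/2 - 4 * d \<le> y" for y
    using \<theta> by (simp add: f_gap[OF that] tent_def)

  \<comment> \<open>\<open>WL\<close> and \<open>WN\<close> are the shares of the coreset near the
    left end and near the right half of the gap.\<close>
  define WL where "WL = w * (\<Sum>i\<in>I. of_bool (x i \<le> -1/2 + d))"
  define WN where "WN = w * (\<Sum>i\<in>I. of_bool (1/2 - 3 * d \<le> x i))"
  have \<eta>0: "0 \<le> \<eta>" "\<eta> \<le> d\<^sup>2 / 32"
    using H(2) \<eta> by (auto simp: \<eta>_def)
  have \<tau>0: "0 \<le> \<tau>" using H(2) by (auto simp: \<tau>_def)
  have P1: "(\<integral>y. H (u - y) * indicator A y \<partial>lborel) \<le> 1" if "A \<in> sets borel" for u A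
    using integral_window_le[OF Hint(1) H(2) that, of UNIV u] Hint(2) by simp

  \<comment> \<open>The left tent has slope at least 4, so it is at least \<open>d\<close> from
    \<open>-1/2 + d/4\<close> to \<open>-1/2 + d/2\<close>. Points right of \<open>-1/2 + d\<close>
    are more than \<open>d / 2 \<ge> \<rho>\<close> away and send there at most the tail
    \<eta>.\<close>
  have WL_ge: "(1 - \<theta>) * (d\<^sup>2 / 4) \<le> WL + \<eta> + E"
  proof -
    have "(1 - \<theta>) * d * ((-1/2 + d/2) - (-1/2 + d/4)) \<le> (\<integral>y. f y * indicator {-1/2..-1/2 + d/2} y \<partial>lborel)"
    proof (rule real_integral_ge_const_interval[OF fd f0])
      fix y assume y: "y \<in> {-1/2 + d/4..-1/2 + d/2}"
      have "d \<le> (y + 1/2) * 4" using y by auto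
      also have "\<dots> \<le> (y + 1/2) * (1 / a\<^sup>2)"
      proof (rule mult_left_mono)
        have "a\<^sup>2 \<le> (1/2)\<^sup>2" using a by (intro power_mono) auto
        then show "4 \<le> 1 / a\<^sup>2" using a by (simp add: field_simps power2_eq_square)
      qed (use y d0 in auto)
      also have "\<dots> = tent (a - 1/2) a y"
        using y d0 a by (subst tent_eq) (auto simp: abs_if)
      finally have "(1 - \<theta>) * d \<le> (1 - \<theta>) * tent (a - 1/2) a y"
        using \<theta> by (intro mult_left_mono) auto
      also have "\<dots> \<le> f y"
        using \<theta> tent_nonneg[of "1/2" 0 y] by (simp add: f_def)
      finally show "(1 - \<theta>) * d \<le> f y" .
    qed (use d0 in auto)
    also have "\<dots> \<le> (\<integral>y. g y * indicator {-1/2..-1/2 + d/2} y \<partial>lborel) + E"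
      using d0 by (intro fg) auto
    also have "(\<integral>y. g y * indicator {-1/2..-1/2 + d/2} y \<partial>lborel) \<le>
        w * (\<Sum>i\<in>I. of_bool (x i \<le> -1/2 + d) + \<eta>)"
      unfolding intg[OF borel_closed[OF closed_atLeastAtMost]]
    proof (rule wsum0)
      fix i assume "i \<in> I"
      show "(\<integral>y. H (x i - y) * indicator {-1/2..-1/2 + d/2} y \<partial>lborel) \<le> of_bool (x i \<le> -1/2 + d) + \<eta>"
      proof (cases "x i \<le> -1/2 + d")
        case True
        then show ?thesis using P1[of "{-1/2..-1/2 + d/2}" "x i"] \<eta>0 by simp
      next
        case False
        then show ?thesis unfolding \<eta>_def using \<rho>
          by (auto intro!: integral_window_le[OF Hint(1) H(2)])
      qed
    qed
    also have "\<dots> = WL + w * (\<Sum>i\<in>I. \<eta>)"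
      by (simp add: WL_def sum.distrib distrib_left)
    finally show ?thesis using wsum[OF \<eta>0(1)] by (simp add: power2_eq_square field_simps)
  qed

  \<comment> \<open>The points of weight \<open>WL\<close> within distance \<open>d\<close> of \<open>-1/2\<close> leak at least \<open>\<tau>\<close> to the left of \<open>-1/2\<close>, where \<open>f\<close>
    vanishes; so \<open>\<tau>\<close> bounds both the leak and the help that far points can give on the gap.\<close>
  have leak: "WL * \<tau> \<le> E"
  proof -
    have "WL * \<tau> = w * (\<Sum>i\<in>I. of_bool (x i \<le> -1/2 + d) * \<tau>)"
      by (simp add: WL_def sum_distrib_right)
    also have "\<dots> \<le> (\<integral>y. g y * indicator {-3/2..-1/2} y \<partial>lborel)"
      unfolding intg[OF borel_closed[OF closed_atLeastAtMost]]
    proof (rule wsum0)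
      fix i assume i: "i \<in> I"
      show "of_bool (x i \<le> -1/2 + d) * \<tau> \<le> (\<integral>y. H (x i - y) * indicator {-3/2..-1/2} y \<partial>lborel)"
      proof (cases "x i \<le> -1/2 + d")
        case True
        then show ?thesis using x[OF i] unfolding \<tau>_def
          by (auto intro!: integral_window_ge[OF Hint(1) H(2)])
      next
        case False
        then show ?thesis using H(2) by simp
      qed
    qed
    also have "\<dots> \<le> (\<integral>y. f y * indicator {-3/2..-1/2} y \<partial>lborel) + E"
      by (rule gf) auto
    also have "(\<integral>y. f y * indicator {-3/2..-1/2} y \<partial>lborel) = (\<integral>y. 0 \<partial>(lborel :: real measure))"
      by (intro Bochner_Integration.integral_cong) (auto simp: indicator_def f_out)
    finally show ?thesis by simp
  qed

  \<comment> \<open>A point right of \<open>1/2 - 3 * d\<close> keeps mass \<open>1 - \<eta>\<close>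
    within distance \<open>d\<close>, hence in \<open>{1/2 - 4 * d..1/2 + d}\<close>. There the
    density is at most \<open>2 * \<theta>\<close>, and the length \<open>5 * d\<close> is below
    1.\<close>
  have WN_le: "WN * (1 - \<eta>) \<le> 2 * \<theta> + E"
  proof -
    have core: "1 - \<eta> \<le> (\<integral>t. H t * indicator {-d..d} t \<partial>lborel)"
    proof -
      have "1 = (\<integral>t. H t * indicator {t. \<rho> < \<bar>t\<bar>} t + H t * indicator {t. \<not> \<rho> < \<bar>t\<bar>} t \<partial>lborel)"
        unfolding Hint(2)[symmetric] by (intro Bochner_Integration.integral_cong) (auto simp: indicator_def)
      also have "\<dots> = \<eta> + (\<integral>t. H t * indicator {t. \<not> \<rho> < \<bar>t\<bar>} t \<partial>lborel)"
        unfolding \<eta>_def by (intro Bochner_Integration.integral_add HA) auto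
      also have "(\<integral>t. H t * indicator {t. \<not> \<rho> < \<bar>t\<bar>} t \<partial>lborel) \<le> (\<integral>t. H t * indicator {-d..d} t \<partial>lborel)"
        using \<rho> H(2) by (intro integral_mono HA) (auto split: split_indicator)
      finally show ?thesis by simp
    qed
    have "WN * (1 - \<eta>) = w * (\<Sum>i\<in>I. of_bool (1/2 - 3 * d \<le> x i) * (1 - \<eta>))"
      by (simp add: WN_def sum_distrib_right)
    also have "\<dots> \<le> (\<integral>y. g y * indicator {1/2 - 4 * d..1/2 + d} y \<partial>lborel)"
      unfolding intg[OF borel_closed[OF closed_atLeastAtMost]]
    proof (rule wsum0)
      fix i assume i: "i \<in> I"
      show "of_bool (1/2 - 3 * d \<le> x i) * (1 - \<eta>) \<le> (\<integral>y. H (x i - y) * indicator {1/2 - 4 * d..1/2 + d} y \<partial>lborel)"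
      proof (cases "1/2 - 3 * d \<le> x i")
        case True
        then have "(\<integral>t. H t * indicator {-d..d} t \<partial>lborel) \<le> (\<integral>y. H (x i - y) * indicator {1/2 - 4 * d..1/2 + d} y \<partial>lborel)"
          using x[OF i] by (intro integral_window_ge[OF Hint(1) H(2)]) auto
        then show ?thesis using core True by simp
      next
        case False
        then show ?thesis using H(2) by simp
      qed
    qed
    also have "\<dots> \<le> (\<integral>y. f y * indicator {1/2 - 4 * d..1/2 + d} y \<partial>lborel) + E"
      using d0 by (intro gf) auto
    also have "(\<integral>y. f y * indicator {1/2 - 4 * d..1/2 + d} y \<partial>lborel) \<le> (\<integral>y. 2 * \<theta> * indicator {1/2 - 4 * d..1/2 + d} y \<partial>lborel)"
      using d0 f_le by (intro integral_mono fA) (auto split: split_indicator)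
    also have "\<dots> \<le> 2 * \<theta>"
      using d0 \<theta> by (simp add: mult_le_cancel_left1 field_simps)
    finally show ?thesis by simp
  qed

  \<comment> \<open>\<open>f\<close> is dominated by \<open>\<bar>g - f\<bar>\<close>, the far points and the tails of the near points, except within
    distance \<open>\<rho>\<close> of a near point, where the summand \<open>2 * \<theta> * M\<close> of weight \<open>w\<close> exceeds it.\<close>
  have J: "4 * \<theta> * d\<^sup>2 \<le> E + \<tau> + WN * (\<eta> + 4 * \<theta> * M * \<rho>)"
  proof -
    let ?J = "{1/2 - 2 * d..1/2}"
    define near where "near i \<longleftrightarrow> 1/2 - 3 * d \<le> x i" for i
    \<comment> \<open>The core of a near kernel, whose mass is close to 1, is replaced by a slab of
      mass only \<open>4 * \<theta> * M * \<rho>\<close>. Since a nonempty coreset has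
      \<open>w \<ge> 1 / M\<close>, the weighted slab still has height at least
      \<open>2 * \<theta>\<close>.\<close>
    define G where "G i y = (if near i then H (x i - y) * indicator {t. \<rho> < \<bar>t\<bar>} (x i - y)
        + 2 * \<theta> * M * indicator {-\<rho>..\<rho>} (x i - y) else H (x i - y) * indicator ?J y)" for i y
    have G0: "0 \<le> G i y" for i y
      using H(2) \<theta> by (simp add: G_def)
    have ind: "integrable lborel (indicator {-\<rho>..\<rho>} :: real \<Rightarrow> real)"
      using \<rho>(1) by (intro integrable_real_indicator) auto
    have Gint: "integrable lborel (G i)" for i
      using HA[of "{t. \<rho> < \<bar>t\<bar>}"] HxA[of ?J "x i"]
        lborel_integrable_reflect[of "\<lambda>t. H t * indicator {t. \<rho> < \<bar>t\<bar>} t" "x i"]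
        lborel_integrable_reflect[OF ind, of "x i"]
      by (cases "near i") (simp_all add: G_def[abs_def])
    \<comment> \<open>The full tent has slope 4 and vanishes at 1/2, so it is at least
      \<open>4 * d\<close> up to \<open>1/2 - d\<close>.\<close>
    have "4 * d * \<theta> * ((1/2 - d) - (1/2 - 2 * d)) \<le> (\<integral>y. f y * indicator ?J y \<partial>lborel)"
    proof (rule real_integral_ge_const_interval[OF fd f0])
      fix y assume y: "y \<in> {1/2 - 2 * d..1/2 - d}"
      then show "4 * d * \<theta> \<le> f y"
        using d0 \<theta> f_gap[of y] by (subst f_gap) (auto simp: tent_eq power2_eq_square)
    qed (use d0 in auto)
    also have "\<dots> \<le> (\<integral>y. \<bar>g y - f y\<bar> * indicator ?J y + w * (\<Sum>i\<in>I. G i y) \<partial>lborel)"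
    proof (rule integral_mono)
      fix y
      have S0: "0 \<le> w * (\<Sum>i\<in>I. G i y)"
        using w0 G0 by (simp add: sum_nonneg)
      show "f y * indicator ?J y \<le> \<bar>g y - f y\<bar> * indicator ?J y + w * (\<Sum>i\<in>I. G i y)"
      proof (cases "y \<in> ?J")
        case y: True
        show ?thesis
        proof (cases "\<exists>i\<in>I. near i \<and> \<bar>x i - y\<bar> \<le> \<rho>")
          case True
          then obtain i where i: "i \<in> I" "near i" "\<bar>x i - y\<bar> \<le> \<rho>" by auto
          have c: "0 < card I" using i(1) I(1) card_gt_0_iff by blast
          have "f y \<le> 2 * \<theta>" using y d0 by (intro f_le) auto
          also have "\<dots> \<le> w * (2 * \<theta> * M)"
            using c I(2) \<theta> by (simp add: w_def field_simps)
          also have "\<dots> \<le> w * G i y"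
            using i w0 H(2) by (intro mult_left_mono) (auto simp: G_def abs_le_iff)
          also have "\<dots> \<le> w * (\<Sum>i\<in>I. G i y)"
            using w0 I(1) i(1) G0 by (intro mult_left_mono member_le_sum) auto
          finally show ?thesis using y by simp
        next
          case False
          have "g y \<le> w * (\<Sum>i\<in>I. G i y)"
            unfolding g_def using False y \<theta> by (intro wsum0) (auto simp: G_def)
          then show ?thesis using y by simp
        qed
      qed (use S0 in simp)
    next
      show "integrable lborel (\<lambda>y. \<bar>g y - f y\<bar> * indicator ?J y + w * (\<Sum>i\<in>I. G i y))"
        using Gint d0 by (intro Bochner_Integration.integrable_add D(1) integrable_mult_right
            Bochner_Integration.integrable_sum) auto
    qed (rule fA, simp)
    also have "\<dots> = (\<integral>y. \<bar>g y - f y\<bar> * indicator ?J y \<partial>lborel) + w * (\<Sum>i\<in>I. integral\<^sup>L lborel (G i))"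
      using Gint d0 D(1)[of "1/2 - 2 * d" "1/2"]
      by (subst Bochner_Integration.integral_add) (auto intro!: integrable_mult_right)
    also have "(\<integral>y. \<bar>g y - f y\<bar> * indicator ?J y \<partial>lborel) \<le> E"
      using d0 by (intro D(2)) auto
    also have "w * (\<Sum>i\<in>I. integral\<^sup>L lborel (G i)) \<le>
        w * (\<Sum>i\<in>I. of_bool (near i) * (\<eta> + 4 * \<theta> * M * \<rho>) + \<tau>)"
    proof (rule wsum0)
      fix i assume i: "i \<in> I"
      show "integral\<^sup>L lborel (G i) \<le> of_bool (near i) * (\<eta> + 4 * \<theta> * M * \<rho>) + \<tau>"
      proof (cases "near i")
        case True
        have "integral\<^sup>L lborel (G i) = (\<integral>t. H t * indicator {t. \<rho> < \<bar>t\<bar>} t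
            + 2 * \<theta> * M * indicator {-\<rho>..\<rho>} t \<partial>lborel)"
          using True lborel_integral_reflect[of "\<lambda>t. H t * indicator {t. \<rho> < \<bar>t\<bar>} t
            + 2 * \<theta> * M * indicator {-\<rho>..\<rho>} t" "x i"] by (simp add: G_def[abs_def])
        also have "\<dots> = \<eta> + 2 * \<theta> * M * (2 * \<rho>)"
          using \<rho>(1) HA[of "{t. \<rho> < \<bar>t\<bar>}"] unfolding \<eta>_def
          by (subst Bochner_Integration.integral_add) auto
        finally show ?thesis using True \<tau>0 by simp
      next
        case False
        have "integral\<^sup>L lborel (G i) = (\<integral>y. H (x i - y) * indicator ?J y \<partial>lborel)"
          using False by (simp add: G_def[abs_def])
        also have "\<dots> \<le> (\<integral>t. H t * indicator {-1..-d} t \<partial>lborel)"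
          using False x[OF i] by (intro integral_window_le[OF Hint(1) H(2)]) (auto simp: near_def)
        also have "\<dots> = (\<integral>t. H (0 - t) * indicator {-1..-d} (0 - t) \<partial>lborel)"
          by (rule lborel_integral_reflect[symmetric])
        also have "\<dots> = \<tau>"
          unfolding \<tau>_def using H(3) by (intro Bochner_Integration.integral_cong) (auto simp: indicator_def)
        finally show ?thesis using False by simp
      qed
    qed
    also have "\<dots> = WN * (\<eta> + 4 * \<theta> * M * \<rho>) + w * (\<Sum>i\<in>I. \<tau>)"
      by (simp add: WN_def near_def sum.distrib distrib_left flip: sum_distrib_right)
    finally show ?thesis using wsum[OF \<tau>0] by (simp add: power2_eq_square field_simps)
  qed

  have d2: "0 < d\<^sup>2" "d\<^sup>2 \<le> 1/64"
    using d0 power_mono[of d "1/8" 2] by (auto simp: power2_eq_square)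
  have E_le: "E \<le> d\<^sup>2 / 32" "E \<le> \<theta>" "0 \<le> E"
  proof -
    have E_eq: "E = (\<theta> / 8 * d\<^sup>2) * d\<^sup>2" by (simp add: E_def power4_eq_xxxx power2_eq_square)
    have "\<theta> / 8 * d\<^sup>2 \<le> 1/32 * 1" using d2 \<theta> by (intro mult_mono) auto
    then show "E \<le> d\<^sup>2 / 32" unfolding E_eq using d2 mult_right_mono[of "\<theta> / 8 * d\<^sup>2" "1/32" "d\<^sup>2"] by simp
    have "d\<^sup>2 * d\<^sup>2 \<le> 1 * 1" using d2 by (intro mult_mono) auto
    then show "E \<le> \<theta>" unfolding E_eq using \<theta> mult_left_mono[of "d\<^sup>2 * d\<^sup>2" 1 "\<theta> / 8"] by (simp add: mult.assoc)
    show "0 \<le> E" using \<theta> by (simp add: E_def)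
  qed
  \<comment> \<open>The left end balances as \<open>3/16 - 1/32 - 1/32 = 1/8\<close>, in units of
    \<open>d\<^sup>2\<close>.\<close>
  have "(3/4) * (d\<^sup>2 / 4) \<le> (1 - \<theta>) * (d\<^sup>2 / 4)"
    using \<theta> by (intro mult_right_mono) auto
  then have "d\<^sup>2 / 8 \<le> WL" using WL_ge E_le(1) \<eta>0(2) by simp
  then have "d\<^sup>2 / 8 * \<tau> \<le> E" using leak mult_right_mono[of "d\<^sup>2 / 8" WL \<tau>] \<tau>0 by linarith
  then have "\<tau> * (d * d) \<le> (\<theta> * (d * d)) * (d * d)"
    by (simp add: E_def power4_eq_xxxx power2_eq_square field_simps)
  then have "\<tau> \<le> \<theta> * (d * d)"
    by (rule mult_right_le_imp_le) (use d0 in simp)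
  then have \<tau>_le: "\<tau> \<le> \<theta> * d\<^sup>2"
    by (simp only: power2_eq_square)
  have WN0: "0 \<le> WN" using w0 by (simp add: WN_def sum_nonneg)
  \<comment> \<open>Since \<eta> is below 1/2 and \<open>E \<le> \<theta>\<close>, the weight near
    the gap is at most \<open>2 * (2 * \<theta> + \<theta>)\<close>.\<close>
  have "WN * (1/2) \<le> WN * (1 - \<eta>)" using WN0 \<eta>0 d2 by (intro mult_left_mono) auto
  then have "WN \<le> 6 * \<theta>" using WN_le E_le(2) by simp
  then have "WN * (\<eta> + 4 * \<theta> * M * \<rho>) \<le> (6 * \<theta>) * (d\<^sup>2 / 32 + d\<^sup>2 / 4)"
    using \<eta>0 \<rho> \<theta> WN0 by (intro mult_mono add_mono) auto
  also have "\<dots> = 27 / 16 * (\<theta> * d\<^sup>2)"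
    by (simp add: algebra_simps)
  finally have "WN * (\<eta> + 4 * \<theta> * M * \<rho>) \<le> 27 / 16 * (\<theta> * d\<^sup>2)" .
  moreover have "E \<le> \<theta> * d\<^sup>2 / 8"
  proof -
    have "d\<^sup>2 * d\<^sup>2 \<le> d\<^sup>2 * 1" using d2 by (intro mult_left_mono) auto
    then show ?thesis using \<theta> mult_left_mono[of "d\<^sup>2 * d\<^sup>2" "d\<^sup>2" "\<theta> / 8"]
      by (simp add: E_def power4_eq_xxxx power2_eq_square mult.assoc)
  qed
  moreover have "0 < \<theta> * d\<^sup>2" using \<theta> d2 by simp
  \<comment> \<open>In units of \<open>\<theta> * d\<^sup>2\<close> the supply is at most
    \<open>1/8 + 1 + 27/16\<close>, which is below the required 4.\<close>
  ultimately show False using J \<tau>_le by linarith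
qed

section \<open>Choice of the gap, the core radius and the mixing weight\<close>

lemma integral_tail_small:
  fixes k :: "real \<Rightarrow> real"
  assumes k: "integrable lborel k" and e: "0 < e"
  obtains R where "0 < R" "(\<integral>t. k t * indicator {t. R < \<bar>t\<bar>} t \<partial>lborel) < e"
proof -
  have "(\<lambda>n. \<integral>t. k t * indicator {t. real n < \<bar>t\<bar>} t \<partial>lborel) \<longlonglongrightarrow> (\<integral>t. 0 \<partial>(lborel :: real measure))"
  proof (rule integral_dominated_convergence[where w = "\<lambda>t. \<bar>k t\<bar>"])
    show "AE t in lborel. (\<lambda>n. k t * indicator {t. real n < \<bar>t\<bar>} t) \<longlonglongrightarrow> 0"
    proof (rule AE_I2)
      fix t :: real
      have "\<forall>\<^sub>F n in sequentially. k t * indicator {t. real n < \<bar>t\<bar>} t = 0"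
        using eventually_ge_at_top[of "nat \<lceil>\<bar>t\<bar>\<rceil>"] by eventually_elim (auto simp: indicator_def; linarith)
      then show "(\<lambda>n. k t * indicator {t. real n < \<bar>t\<bar>} t) \<longlonglongrightarrow> 0"
        by (rule tendsto_eventually)
    qed
  qed (use k borel_measurable_integrable[OF k] in \<open>auto split: split_indicator\<close>)
  then have "\<forall>\<^sub>F n in sequentially. (\<integral>t. k t * indicator {t. real n < \<bar>t\<bar>} t \<partial>lborel) < e"
    using e by (intro order_tendstoD) auto
  then obtain n where n: "(\<integral>t. k t * indicator {t. real n < \<bar>t\<bar>} t \<partial>lborel) < e" "0 < n"
    using eventually_gt_at_top[of 0] eventually_happens[OF eventually_conj] by (metis (lifting) sequentially_bot)
  then show thesis using that[of "real n"] by simp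
qed

text \<open>\<open>plateau_lower_bound\<close> is applied with \<open>\<theta> = 1 / N\<close> and
  core radius \<open>R * h\<close>. The product \<open>\<theta> * m * h\<close> is at most
  \<open>N powr (- (2 / l))\<close>, which tends to 0, and \<open>l > 2\<close> makes the core
  radius itself tend to 0.\<close>

lemma small_bandwidth_lower_bound:
  assumes k: "is_kernel k" "\<And>t. 0 \<le> k t" and l: "2 < l" and L: "4 < L"
  shows "\<exists>c>0. \<forall>\<^sub>F N in at_top. \<forall>h>0. h \<le> N powr (- 1 + 2 / l) \<longrightarrow>
    (\<forall>m::nat. real m \<le> N powr (2 - 4 / l) \<longrightarrow> (\<exists>f. hard_density L k h m (ennreal (c / N)) f))"
proof -
  \<comment> \<open>The first entry keeps the slope \<open>1 / a\<^sup>2\<close> within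
    \<open>L\<close> and is below 1/2 because \<open>L > 4\<close>, so a gap remains; the second
    ensures \<open>a > 1/4\<close>.\<close>
  define a where "a = max (1 / sqrt L) (3/8)"
  have "2 < sqrt L" using L by (simp add: real_less_rsqrt)
  then have "1 / sqrt L < 1/2" using L by (simp add: divide_less_eq)
  then have a: "1/4 < a" "a < 1/2" by (auto simp: a_def)
  have "(1 / sqrt L)\<^sup>2 \<le> a\<^sup>2" using L by (intro power_mono) (auto simp: a_def)
  then have aL: "1 / a\<^sup>2 \<le> L" using L a by (simp add: power_divide field_simps)
  define d where "d = (1 - 2 * a) / 4"
  have d0: "0 < d" using a by (simp add: d_def)
  have kb: "has_bochner_integral lborel k 1" and even: "\<And>t. k (- t) = k t"
    using k(1) by (auto simp: is_kernel_def)
  then have kint: "integrable lborel k" by (simp add: has_bochner_integral_iff)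
  \<comment> \<open>Scaling takes \<open>R\<close> to \<open>R * h\<close> without changing the tail
    mass, so one \<open>R\<close> serves all bandwidths.\<close>
  obtain R where R: "0 < R" "(\<integral>t. k t * indicator {t. R < \<bar>t\<bar>} t \<partial>lborel) < d\<^sup>2 / 32"
    using integral_tail_small[OF kint, of "d\<^sup>2 / 32"] d0 by auto
  have lim: "((\<lambda>N. A * N powr (- b)) \<longlongrightarrow> 0) at_top" if "0 < b" for A b :: real
    using tendsto_mult_right_zero[OF tendsto_neg_powr[OF _ filterlim_ident], of "-b" A] that by simp
  have "\<forall>\<^sub>F N in at_top. R * N powr (- (1 - 2 / l)) < d / 2"
    using l d0 by (intro order_tendstoD(2)[OF lim]) auto
  moreover have "\<forall>\<^sub>F N in at_top. 4 * R * N powr (- (2 / l)) < d\<^sup>2 / 4"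
    using l d0 by (intro order_tendstoD(2)[OF lim]) auto
  ultimately have "\<forall>\<^sub>F N in at_top. \<forall>h>0. h \<le> N powr (- 1 + 2 / l) \<longrightarrow>
    (\<forall>m::nat. real m \<le> N powr (2 - 4 / l) \<longrightarrow> (\<exists>f. hard_density L k h m (ennreal (d ^ 4 / 8 / N)) f))"
    using eventually_ge_at_top[of 4]
  proof eventually_elim
    case (elim N)
    show ?case
    proof (intro allI impI)
      fix h :: real and m :: nat
      assume h: "0 < h" "h \<le> N powr (- 1 + 2 / l)" and m: "real m \<le> N powr (2 - 4 / l)"
      let ?\<theta> = "1 / N"
      let ?f = "\<lambda>y. (1 - ?\<theta>) * tent (a - 1/2) a y + ?\<theta> * tent 0 (1/2) y"
      have \<theta>: "0 < ?\<theta>" "?\<theta> \<le> 1/4" using elim(3) by (auto simp: field_simps)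
      show "\<exists>f. hard_density L k h m (ennreal (d ^ 4 / 8 / N)) f"
      proof (rule exI[of _ ?f], unfold hard_density_def, intro conjI allI impI)
        have "tent (a - 1/2) a \<in> lipschitz_densities L"
          using a aL by (intro tent_in_lipschitz_densities) auto
        moreover have "tent 0 (1/2) \<in> lipschitz_densities L"
          using L by (intro tent_in_lipschitz_densities) (auto simp: power2_eq_square)
        ultimately show "?f \<in> lipschitz_densities L"
          using \<theta> by (intro lipschitz_densities_convex) auto
        fix x :: "nat \<Rightarrow> real" and I :: "nat set"
        assume I: "finite I" "card I \<le> m" and x: "\<forall>i\<in>I. x i \<in> {-1/2..1/2}"
        have "ennreal (?\<theta> * d ^ 4 / 8) \<le> norm_L2 (\<lambda>y. (1 / real (card I)) * (\<Sum>i\<in>I. scaled k h (x i - y)) - ?f y)"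
        proof (rule plateau_lower_bound[OF _ _ _ a d_def \<theta> _ I])
          show "has_bochner_integral lborel (scaled k h) 1"
            by (rule has_bochner_integral_scaled[OF kb h(1)])
          show "0 \<le> scaled k h t" "scaled k h (- t) = scaled k h t" for t
            using k(2) even h by (auto simp: scaled_def)
          show "x i \<in> {-1/2..1/2}" if "i \<in> I" for i using x that by blast
          show "0 \<le> R * h" using R h by simp
          have "R * h \<le> R * N powr (- (1 - 2 / l))" using R h by (intro mult_left_mono) auto
          then show "R * h \<le> d / 2" using elim(1) by simp
          have "4 * ?\<theta> * m * (R * h) = 4 * R * (?\<theta> * (m * h))" by simp
          also have "\<dots> \<le> 4 * R * (?\<theta> * (N powr (2 - 4 / l) * N powr (- 1 + 2 / l)))"
            using R h m \<theta> by (intro mult_left_mono mult_mono) auto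
          also have "?\<theta> * (N powr (2 - 4 / l) * N powr (- 1 + 2 / l)) = N powr (- (2 / l))"
          proof -
            have "?\<theta> = N powr (- 1)" using elim(3) by (simp add: powr_minus_divide)
            then have "?\<theta> * (N powr (2 - 4 / l) * N powr (- 1 + 2 / l)) = N powr (- 1 + (2 - 4 / l + (- 1 + 2 / l)))"
              by (simp only: powr_add)
            also have "- 1 + (2 - 4 / l + (- 1 + 2 / l)) = - (2 / l)" using l by (simp add: field_simps)
            finally show ?thesis .
          qed
          finally show "4 * ?\<theta> * m * (R * h) \<le> d\<^sup>2 / 4" using elim(2) by simp
          have "(\<integral>t. scaled k h t * indicator {t. R * h < \<bar>t\<bar>} t \<partial>lborel) =
              h * (\<integral>t. scaled k h (0 + h * t) * indicator {t. R * h < \<bar>t\<bar>} (0 + h * t) \<partial>lborel)"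
            using h by (subst lborel_integral_real_affine[of h _ 0]) auto
          also have "\<dots> = (\<integral>t. h * (scaled k h (0 + h * t) * indicator {t. R * h < \<bar>t\<bar>} (0 + h * t)) \<partial>lborel)"
            by simp
          also have "\<dots> = (\<integral>t. k t * indicator {t. R < \<bar>t\<bar>} t \<partial>lborel)"
            using h(1) by (intro Bochner_Integration.integral_cong)
              (auto simp: scaled_def abs_mult mult.commute[of R] split: split_indicator)
          finally show "(\<integral>t. scaled k h t * indicator {t. R * h < \<bar>t\<bar>} t \<partial>lborel) \<le> d\<^sup>2 / 32"
            using R(2) by simp
        qed
        then show "ennreal (d ^ 4 / 8 / N) \<le> norm_L2 (\<lambda>y. coreset_kde k h x I y - ?f y)"
          by (simp add: coreset_kde_def mult.commute)
      qed
    qed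
  qed
  moreover have "0 < d ^ 4 / 8" using d0 by simp
  ultimately show ?thesis by blast
qed

section \<open>The lower bound\<close>

theorem theorem5:
  fixes k :: "real \<Rightarrow> real"
  assumes "is_kernel k" and "\<And>t. 0 \<le> k t"
  shows "\<exists>c>0. \<forall>(p::real) (l::real) (\<alpha>::real) (L::real).
    1 < p \<longrightarrow> 0 < l \<longrightarrow> 0 < \<alpha> \<longrightarrow> \<alpha> < 1 / 3 \<longrightarrow> 4 < L \<longrightarrow>
    k \<in> O[at_infinity](\<lambda>t. \<bar>t\<bar> powr (- (p + 1))) \<longrightarrow>
    (\<lambda>\<omega>. norm (fourier k \<omega>)) \<in> O[at_infinity](\<lambda>\<omega>. \<bar>\<omega>\<bar> powr (- l)) \<longrightarrow>
    (\<forall>\<^sub>F n in sequentially. \<forall>m::nat.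
       real m \<le> real n powr (2 / 3 - 2 * (\<alpha> * (1 - 2 / l) + 2 / (3 * l))) / ln (real n) \<longrightarrow>
       ennreal (c * (real n powr (- 1 / 3 + \<alpha>) / ln (real n))) \<le> minimax_coreset_risk k L n m)"
\<comment> \<open>The constant 1 serves all parameters: \<open>c1\<close> and \<open>c2\<close>
  below may depend on them, but \<open>ln n\<close> eventually exceeds \<open>1 / c1\<close> and
  \<open>1 / c2\<close>.\<close>
proof (rule exI[of _ 1], intro conjI allI impI)
  fix p l \<alpha> L :: real
  assume l: "0 < l" and \<alpha>: "\<alpha> < 1 / 3" and L: "4 < L"
    and F: "(\<lambda>\<omega>. norm (fourier k \<omega>)) \<in> O[at_infinity](\<lambda>\<omega>. \<bar>\<omega>\<bar> powr (- l))"
  have kint: "integrable lborel k"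
    using assms(1) by (auto simp: is_kernel_def has_bochner_integral_iff)
  define N where "N n = real n powr (1/3 - \<alpha>)" for n
  have N: "filterlim N at_top sequentially"
    unfolding N_def[abs_def]
    using \<alpha> by (intro filterlim_compose[OF real_powr_at_top filterlim_real_sequentially]) auto
  obtain c1 where c1: "0 < c1" and "\<forall>\<^sub>F N in at_top. \<forall>h>0. \<forall>m::nat.
      m = 0 \<or> N powr (- 1 + 2 / l) \<le> h \<longrightarrow> (\<exists>f. hard_density L k h m (ennreal (c1 / N)) f)"
    using large_bandwidth_lower_bound[OF kint l L F] by blast
  from eventually_compose_filterlim[OF this(2) N]
  have ev1: "\<forall>\<^sub>F n in sequentially. \<forall>h>0. \<forall>m::nat.
      m = 0 \<or> N n powr (- 1 + 2 / l) \<le> h \<longrightarrow> (\<exists>f. hard_density L k h m (ennreal (c1 / N n)) f)" .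
  \<comment> \<open>The guard \<open>2 < l\<close> is kept inside so that \<open>c2\<close> exists
    in every case; for smaller \<open>l\<close> the claim is vacuous and the value 1 is a
    dummy.\<close>
  obtain c2 where c2: "0 < c2" and ev2: "\<forall>\<^sub>F n in sequentially. 2 < l \<longrightarrow>
      (\<forall>h>0. h \<le> N n powr (- 1 + 2 / l) \<longrightarrow> (\<forall>m::nat. real m \<le> N n powr (2 - 4 / l) \<longrightarrow>
        (\<exists>f. hard_density L k h m (ennreal (c2 / N n)) f)))"
  proof (cases "2 < l")
    case True
    obtain c where c: "0 < c" and "\<forall>\<^sub>F N in at_top. \<forall>h>0. h \<le> N powr (- 1 + 2 / l) \<longrightarrow>
        (\<forall>m::nat. real m \<le> N powr (2 - 4 / l) \<longrightarrow> (\<exists>f. hard_density L k h m (ennreal (c / N)) f))"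
      using small_bandwidth_lower_bound[OF assms True L] by blast
    from eventually_compose_filterlim[OF this(2) N] show ?thesis
      using True by (intro that[OF c]) simp
  qed (use that[of 1] in simp)
  have ln: "filterlim (\<lambda>n. ln (real n)) at_top sequentially"
    by (intro filterlim_compose[OF ln_at_top filterlim_real_sequentially])
  from ev1 ev2 show "\<forall>\<^sub>F n in sequentially. \<forall>m::nat.
       real m \<le> real n powr (2 / 3 - 2 * (\<alpha> * (1 - 2 / l) + 2 / (3 * l))) / ln (real n) \<longrightarrow>
       ennreal (1 * (real n powr (- 1 / 3 + \<alpha>) / ln (real n))) \<le> minimax_coreset_risk k L n m"
    \<comment> \<open>The threshold 2 makes the budget at most 1/2 when \<open>l \<le> 2\<close>;
      the other two absorb \<open>c1\<close> and \<open>c2\<close>.\<close>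
    using ln[unfolded filterlim_at_top, rule_format, of 2] ln[unfolded filterlim_at_top, rule_format, of "1 / c1"]
      ln[unfolded filterlim_at_top, rule_format, of "1 / c2"] eventually_ge_at_top[of 1]
  proof eventually_elim
    case (elim n)
    have N0: "0 < N n" using elim(6) by (simp add: N_def)
    have le_rate: "ennreal (1 * (real n powr (- 1 / 3 + \<alpha>) / ln (real n))) \<le> ennreal (c / N n)"
      if "0 < c" "1 / c \<le> ln (real n)" for c
    proof (rule ennreal_leI)
      have "real n powr (- 1 / 3 + \<alpha>) = 1 / N n"
        unfolding N_def by (simp flip: powr_minus_divide)
      then show "1 * (real n powr (- 1 / 3 + \<alpha>) / ln (real n)) \<le> c / N n"
        using that N0 elim(3) by (simp add: field_simps)
    qed
    show ?case
    proof (intro allI impI minimax_coreset_risk_ge)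
      fix m :: nat and h :: real
      assume m: "real m \<le> real n powr (2 / 3 - 2 * (\<alpha> * (1 - 2 / l) + 2 / (3 * l))) / ln (real n)"
        and h: "0 < h"
      \<comment> \<open>The exponent factors, which turns the budget into a power of
        \<open>N n\<close>.\<close>
      have "2 / 3 - 2 * (\<alpha> * (1 - 2 / l) + 2 / (3 * l)) = (1/3 - \<alpha>) * (2 - 4 / l)"
        using l by (simp add: field_simps)
      then have m': "real m \<le> N n powr (2 - 4 / l) / ln (real n)"
        using m by (simp add: N_def powr_powr)
      have "N n powr (2 - 4 / l) / ln (real n) \<le> N n powr (2 - 4 / l) / 1"
        using elim(3) by (intro divide_left_mono) auto
      with m' have m2: "real m \<le> N n powr (2 - 4 / l)" by simp
      have weaken: "\<exists>f. hard_density L k h m (ennreal (1 * (real n powr (- 1 / 3 + \<alpha>) / ln (real n)))) f"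
        if "hard_density L k h m (ennreal (c / N n)) f" "0 < c" "1 / c \<le> ln (real n)" for c f
        using that(1) le_rate[OF that(2,3)] unfolding hard_density_def by (blast intro: order.trans)
      show "\<exists>f. hard_density L k h m (ennreal (1 * (real n powr (- 1 / 3 + \<alpha>) / ln (real n)))) f"
      proof (cases "m = 0 \<or> N n powr (- 1 + 2 / l) \<le> h")
        case True
        then show ?thesis using elim(1) h weaken[OF _ c1 elim(4)] by blast
      next
        case False
        \<comment> \<open>Otherwise the exponent of the budget is nonpositive, so
          \<open>m \<le> 1/2\<close> and hence \<open>m = 0\<close>, which belongs to the other
          case.\<close>
        have "2 < l"
        proof (rule ccontr)
          assume "\<not> 2 < l"
          then have "(1/3 - \<alpha>) * (2 - 4 / l) \<le> 0"
            using l \<alpha> by (intro mult_nonneg_nonpos) (auto simp: field_simps)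
          then have "real n powr ((1/3 - \<alpha>) * (2 - 4 / l)) \<le> real n powr 0"
            using elim(6) by (intro powr_mono) auto
          then have "N n powr (2 - 4 / l) \<le> 1"
            using elim(6) by (simp add: N_def powr_powr)
          then have "N n powr (2 - 4 / l) / ln (real n) \<le> 1 / 2"
            using elim(3) by (intro frac_le) auto
          with m' False show False by simp
        qed
        moreover have "h \<le> N n powr (- 1 + 2 / l)" using False by simp
        ultimately show ?thesis
          using elim(2)[rule_format, OF _ h _ m2] weaken[OF _ c2 elim(5)] by blast
      qed
    qed
  qed
qed simp

end
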